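(* Let $v=(v_1,v_2,v_3):\mathbb{R}^3\to\mathbb{R}^3$ be a smooth solution, with pressure $p:\mathbb{R}^3\to\mathbb{R}$, of the stationary Navier-Stokes equations $$(v\cdot\nabla)v=-\nabla p+\Delta v,\qquad \mathrm{div}\, v=0\quad\text{on }\mathbb{R}^3,$$ satisfying $|v(x)|\to 0$ uniformly as $|x|\to+\infty$. Let $\omega=\mathrm{curl}\, v=\nabla\times v$, and suppose there exists $q\in[\frac32,3)$ such that $\omega\in L^q(\mathbb{R}^3)$. For $(x,y)\in\mathbb{R}^3\times\mathbb{R}^3$ with $x\neq y$ set $$\Phi(x,y):=\frac{1}{4\pi}\frac{\omega(x)\cdot\big[(x-y)\times(v(y)\times\omega(y))\big]}{|x-y|^3},$$ $$\Phi_+(x,y):=\max\{0,\Phi(x,y)\},\qquad \Phi_-(x,y):=\max\{0,-\Phi(x,y)\}.$$ Then either $v=0$ on $\mathbb{R}^3$, or $$\int_{\mathbb{R}^3}\int_{\mathbb{R}^3}\Phi_+(x,y)\,dx\,dy=\int_{\mathbb{R}^3}\int_{\mathbb{R}^3}\Phi_-(x,y)\,dx\,dy=+\infty.$$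
   Context: Here $\times$ between vectors is the cross product in $\mathbb{R}^3$, $\nabla\times$ is the curl, and $(v\cdot\nabla)v=\sum_{i=1}^3 v_i\partial_{x_i}v$. Smooth solution means that $v$ and $p$ are smooth functions on $\mathbb{R}^3$ satisfying the equations pointwise. *)

theory Defs
  imports "HOL-Analysis.Analysis"
begin

unbundle cross3_syntax

text \<open>The derivative of \<open>f\<close> at \<open>x\<close> in the \<open>i\<close>-th coordinate direction. It is only meaningful
  where \<open>f\<close> is differentiable, which is ensured below by the smoothness of \<open>v\<close> and \<open>p\<close>.\<close>

definition partial :: "'n::finite \<Rightarrow> (real^'n \<Rightarrow> 'b::real_normed_vector) \<Rightarrow> real^'n \<Rightarrow> 'b" where
  "partial i f x = frechet_derivative f (at x) (axis i 1)"

primrec C_k :: "nat \<Rightarrow> (real^'n::finite \<Rightarrow> 'b::real_normed_vector) \<Rightarrow> bool" where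
  "C_k 0 f \<longleftrightarrow> continuous_on UNIV f"
| "C_k (Suc k) f \<longleftrightarrow> f differentiable_on UNIV \<and> (\<forall>i. C_k k (partial i f))"

definition smooth :: "(real^'n::finite \<Rightarrow> 'b::real_normed_vector) \<Rightarrow> bool" where
  "smooth f \<longleftrightarrow> (\<forall>k. C_k k f)"

definition grad :: "(real^'n::finite \<Rightarrow> real) \<Rightarrow> real^'n \<Rightarrow> real^'n" where
  "grad p x = (\<chi> i. partial i p x)"

definition divergence :: "(real^'n::finite \<Rightarrow> real^'n) \<Rightarrow> real^'n \<Rightarrow> real" where
  "divergence v x = (\<Sum>i\<in>UNIV. partial i (\<lambda>y. v y $ i) x)"

definition laplacian :: "(real^'n::finite \<Rightarrow> 'b::real_normed_vector) \<Rightarrow> real^'n \<Rightarrow> 'b" where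
  "laplacian f x = (\<Sum>i\<in>UNIV. partial i (partial i f) x)"

definition convective :: "(real^'n::finite \<Rightarrow> real^'n) \<Rightarrow> (real^'n \<Rightarrow> 'b::real_normed_vector) \<Rightarrow> real^'n \<Rightarrow> 'b"
  where "convective v f x = (\<Sum>i\<in>UNIV. (v x $ i) *\<^sub>R partial i f x)"

definition curl :: "(real^3 \<Rightarrow> real^3) \<Rightarrow> real^3 \<Rightarrow> real^3" where
  "curl v x = vector
     [partial 2 (\<lambda>y. v y $ 3) x - partial 3 (\<lambda>y. v y $ 2) x,
      partial 3 (\<lambda>y. v y $ 1) x - partial 1 (\<lambda>y. v y $ 3) x,
      partial 1 (\<lambda>y. v y $ 2) x - partial 2 (\<lambda>y. v y $ 1) x]"

definition smooth_stationary_NS :: "(real^3 \<Rightarrow> real^3) \<Rightarrow> (real^3 \<Rightarrow> real) \<Rightarrow> bool" where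
  "smooth_stationary_NS v p \<longleftrightarrow> smooth v \<and> smooth p \<and>
     (\<forall>x. convective v v x = - grad p x + laplacian v x) \<and>
     (\<forall>x. divergence v x = 0)"

definition in_Lp :: "real \<Rightarrow> ('a::euclidean_space \<Rightarrow> 'b::euclidean_space) \<Rightarrow> bool" where
  "in_Lp q f \<longleftrightarrow> f \<in> borel_measurable lborel \<and> integrable lborel (\<lambda>x. norm (f x) powr q)"

text \<open>On the diagonal, which is a null set, \<open>Phi v x x = 0\<close> because division by zero yields zero.\<close>

definition Phi :: "(real^3 \<Rightarrow> real^3) \<Rightarrow> real^3 \<Rightarrow> real^3 \<Rightarrow> real" where
  "Phi v x y = 1 / (4 * pi) *
     ((curl v x \<bullet> ((x - y) \<times> (v y \<times> curl v y))) / norm (x - y) ^ 3)"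

definition Phi_pos :: "(real^3 \<Rightarrow> real^3) \<Rightarrow> real^3 \<Rightarrow> real^3 \<Rightarrow> real" where
  "Phi_pos v x y = max 0 (Phi v x y)"

definition Phi_neg :: "(real^3 \<Rightarrow> real^3) \<Rightarrow> real^3 \<Rightarrow> real^3 \<Rightarrow> real" where
  "Phi_neg v x y = max 0 (- Phi v x y)"

end

theory Submission
  imports Defs
begin

text \<open>
  Write \<open>\<omega> = curl v\<close> and \<open>w = v \<times> \<omega>\<close>. Because \<open>div v = 0\<close>, the velocity satisfies \<open>\<Delta>v = - curl \<omega>\<close>.
  Because \<open>(v \<bullet> \<nabla>) v\<close> is a gradient minus \<open>w\<close>, taking the curl of the equation removes the pressure
  and leaves \<open>\<Delta>\<omega> = - curl w\<close> (\<open>vorticity_equation\<close>). Tested with a constant vector \<open>a\<close>, both are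
  Poisson equations in divergence form, \<open>\<Delta>(a \<bullet> v) = div (a \<times> \<omega>)\<close> and \<open>\<Delta>(a \<bullet> \<omega>) = div (a \<times> w)\<close>.
  Here \<open>v\<close> tends to zero at infinity and \<open>\<omega>\<close>, \<open>w\<close> lie in \<open>L^q\<close> with \<open>1 < q < 3\<close>, so both can be solved
  by the Newtonian potential without contributions from infinity (\<open>newtonian_representation\<close>):
  with one constant \<open>\<kappa> > 0\<close>,

    \<open>\<kappa> a \<bullet> v(y) = - \<integral> (x - y) \<bullet> (a \<times> \<omega>(x)) / |x - y|^3 dx\<close>,
    \<open>\<kappa> a \<bullet> \<omega>(x) = - \<integral> (y - x) \<bullet> (a \<times> w(y)) / |x - y|^3 dy\<close>.

  The numerator of \<open>\<Phi>\<close> is a triple product, so \<open>\<Phi>\<close> is the integrand of the first formula for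
  \<open>a = w(y)\<close> and of the second for \<open>a = \<omega>(x)\<close>, up to the factor \<open>1 / (4 \<pi>)\<close>. Hence
  \<open>\<integral> \<Phi>(x,y) dx\<close> is a multiple of \<open>w(y) \<bullet> v(y) = 0\<close>, whereas \<open>\<integral> \<Phi>(x,y) dy = - c |\<omega>(x)|^2\<close> with
  \<open>c > 0\<close>. By the first identity, \<open>\<Phi>_+\<close> and \<open>\<Phi>_-\<close> have the same iterated integral \<open>A\<close>. Integrating in
  the other order, which Tonelli allows, the second identity gives \<open>A = A + c \<integral> |\<omega>|^2\<close>. If \<open>A\<close> is
  finite, \<open>\<omega>\<close> vanishes almost everywhere, and the first representation formula gives \<open>v = 0\<close>.

  The representation formula comes from testing \<open>\<Delta>u = div F\<close> with \<open>\<phi> = G_\<epsilon> - G_R\<close>, where \<open>G_r\<close> is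
  \<open>1 / |z|\<close> with its core \<open>|z| < r\<close> replaced by a polynomial in \<open>|z|^2\<close> that matches to second order.
  This \<open>\<phi>\<close> is \<open>C^2\<close> and vanishes for \<open>|z| \<ge> R\<close>, so that one function serves both as the mollified
  kernel and as the cutoff at infinity. Moreover \<open>- \<Delta>G_r\<close> is a nonnegative bump on \<open>|z| \<le> r\<close>
  whose mass \<open>\<kappa>\<close> does not depend on \<open>r\<close>, and \<open>|\<nabla>G_r|\<close> is at most \<open>5/2\<close> times \<open>1 / |z|^2\<close> for all \<open>r\<close>,
  so both limits \<open>R \<rightarrow> \<infinity>\<close> and \<open>\<epsilon> \<rightarrow> 0\<close> follow by dominated convergence.
\<close>

section \<open>Calculus of partial derivatives\<close>

lemma partial_eqI:
  assumes "(f has_derivative f') (at x)"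
  shows "partial i f x = f' (axis i 1)"
  using frechet_derivative_at[OF assms] by (simp add: partial_def)

lemma C_k_differentiable: "C_k (Suc k) f \<Longrightarrow> f differentiable (at x)"
  by (simp add: differentiable_on_def)

lemma C_k_partial: "C_k (Suc k) f \<Longrightarrow> C_k k (partial i f)"
  by simp

lemma C_k_SucD: "C_k (Suc k) f \<Longrightarrow> C_k k f"
  by (induction k arbitrary: f) (auto intro: differentiable_imp_continuous_on)

lemma C_k_continuous: "C_k k f \<Longrightarrow> continuous_on UNIV f"
  by (induction k) (auto intro: differentiable_imp_continuous_on)

lemma smooth_C_k: "smooth f \<Longrightarrow> C_k k f"
  by (simp add: smooth_def)

lemma partial_add:
  assumes "f differentiable (at x)" "g differentiable (at x)"
  shows "partial i (\<lambda>y. f y + g y) x = partial i f x + partial i g x"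
proof -
  have "((\<lambda>y. f y + g y) has_derivative
      (\<lambda>h. frechet_derivative f (at x) h + frechet_derivative g (at x) h)) (at x)"
    using assms by (intro has_derivative_add) (simp_all add: frechet_derivative_works)
  from partial_eqI[OF this] show ?thesis
    by (simp add: partial_def)
qed

lemma partial_bounded_linear:
  assumes "bounded_linear L" "f differentiable (at x)"
  shows "partial i (\<lambda>y. L (f y)) x = L (partial i f x)"
proof -
  have "((\<lambda>y. L (f y)) has_derivative (\<lambda>h. L (frechet_derivative f (at x) h))) (at x)"
    using assms bounded_linear.has_derivative frechet_derivative_works by blast
  from partial_eqI[OF this] show ?thesis
    by (simp add: partial_def)
qed

lemma partial_bounded_bilinear:
  assumes "bounded_bilinear B" "f differentiable (at x)" "g differentiable (at x)"
  shows "partial i (\<lambda>y. B (f y) (g y)) x = B (f x) (partial i g x) + B (partial i f x) (g x)"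
proof -
  have "((\<lambda>y. B (f y) (g y)) has_derivative
      (\<lambda>h. B (f x) (frechet_derivative g (at x) h) + B (frechet_derivative f (at x) h) (g x))) (at x)"
    using assms by (intro bounded_bilinear.FDERIV) (auto simp: frechet_derivative_works)
  from partial_eqI[OF this] show ?thesis
    by (simp add: partial_def)
qed

lemma C_k_add: "C_k k f \<Longrightarrow> C_k k g \<Longrightarrow> C_k k (\<lambda>y. f y + g y)"
proof (induction k arbitrary: f g)
  case 0
  then show ?case by (auto intro: continuous_intros)
next
  case (Suc k)
  then have "partial i (\<lambda>y. f y + g y) = (\<lambda>x. partial i f x + partial i g x)" for i
    by (intro ext partial_add) (auto intro: C_k_differentiable)
  with Suc show ?case
    by (auto intro: differentiable_on_add)
qed

lemma C_k_const: "C_k k (\<lambda>_ :: real^'n::finite. c)"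
proof (induction k arbitrary: c)
  case (Suc k)
  have "partial i (\<lambda>_ :: real^'n. c) = (\<lambda>_. 0)" for i
    by (intro ext) (simp add: partial_def)
  then show ?case using Suc by simp
qed simp

lemma C_k_sum:
  "(\<And>a. a \<in> A \<Longrightarrow> C_k k (f a)) \<Longrightarrow> C_k k (\<lambda>y. \<Sum>a\<in>A. f a y)"
  by (induction A rule: infinite_finite_induct) (auto intro: C_k_add C_k_const)

lemma partial_sum:
  assumes "\<And>a. a \<in> A \<Longrightarrow> f a differentiable (at x)"
  shows "partial i (\<lambda>y. \<Sum>a\<in>A. f a y) x = (\<Sum>a\<in>A. partial i (f a) x)"
proof -
  have "((\<lambda>y. \<Sum>a\<in>A. f a y) has_derivative (\<lambda>h. \<Sum>a\<in>A. frechet_derivative (f a) (at x) h)) (at x)"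
    using assms by (intro has_derivative_sum) (simp add: frechet_derivative_works)
  from partial_eqI[OF this] show ?thesis
    by (simp add: partial_def)
qed

lemma C_k_bounded_linear:
  assumes "bounded_linear L"
  shows "C_k k f \<Longrightarrow> C_k k (\<lambda>y. L (f y))"
proof (induction k arbitrary: f)
  case 0
  then show ?case using assms by (auto intro: bounded_linear.continuous_on)
next
  case (Suc k)
  then have "partial i (\<lambda>y. L (f y)) = (\<lambda>x. L (partial i f x))" for i
    by (intro ext partial_bounded_linear assms) (auto intro: C_k_differentiable)
  moreover have "(\<lambda>y. L (f y)) differentiable (at x)" for x
    using C_k_differentiable[OF Suc.prems, of x] bounded_linear.has_derivative[OF assms]
    unfolding differentiable_def by blast
  ultimately show ?case using Suc by (auto simp: differentiable_on_def)
qed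

lemma C_k_bounded_bilinear:
  assumes "bounded_bilinear B"
  shows "C_k k f \<Longrightarrow> C_k k g \<Longrightarrow> C_k k (\<lambda>y. B (f y) (g y))"
proof (induction k arbitrary: f g)
  case 0
  then show ?case using assms by (auto intro: bounded_bilinear.continuous_on)
next
  case (Suc k)
  then have "partial i (\<lambda>y. B (f y) (g y)) = (\<lambda>x. B (f x) (partial i g x) + B (partial i f x) (g x))" for i
    by (intro ext partial_bounded_bilinear assms) (auto intro: C_k_differentiable)
  moreover have "(\<lambda>y. B (f y) (g y)) differentiable (at x)" for x
    using C_k_differentiable[OF Suc.prems(1), of x] C_k_differentiable[OF Suc.prems(2), of x]
      bounded_bilinear.FDERIV[OF assms] unfolding differentiable_def by blast
  moreover have "C_k k (\<lambda>x. B (f x) (partial i g x) + B (partial i f x) (g x))" for i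
    by (intro C_k_add Suc.IH) (use Suc.prems in \<open>auto intro: C_k_SucD C_k_partial\<close>)
  ultimately show ?case
    by (auto simp: differentiable_on_def)
qed

lemma has_field_derivative_along_axis:
  fixes f :: "real^'n::finite \<Rightarrow> real"
  assumes "f differentiable (at (x + t *\<^sub>R axis i 1))"
  shows "((\<lambda>t. f (x + t *\<^sub>R axis i 1)) has_field_derivative partial i f (x + t *\<^sub>R axis i 1)) (at t within S)"
proof -
  let ?y = "x + t *\<^sub>R axis i 1"
  have 1: "((\<lambda>t. x + t *\<^sub>R axis i 1) has_derivative (\<lambda>h. h *\<^sub>R axis i 1)) (at t within S)"
    by (auto intro!: derivative_eq_intros)
  have 2: "(f has_derivative frechet_derivative f (at ?y)) (at ?y)"
    using assms frechet_derivative_works by blast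
  have "((\<lambda>t. f (x + t *\<^sub>R axis i 1)) has_derivative (\<lambda>h. frechet_derivative f (at ?y) (h *\<^sub>R axis i 1))) (at t within S)"
    using has_derivative_compose[OF 1 2] .
  moreover have "(\<lambda>h. frechet_derivative f (at ?y) (h *\<^sub>R axis i 1)) = (*) (partial i f ?y)"
    using 2 by (auto simp: partial_def linear_cmul has_derivative_linear)
  ultimately show ?thesis
    by (simp add: has_field_derivative_def)
qed

text \<open>The left-hand side is symmetric in \<open>i\<close> and \<open>j\<close>, while the mean value theorem, applied first along
  \<open>i\<close> and then along \<open>j\<close>, turns it into one of the two mixed derivatives near \<open>x\<close>. Comparing with
  the same statement for \<open>i\<close> and \<open>j\<close> exchanged shows that mixed derivatives commute.\<close>

lemma second_difference_mean_value:
  fixes f :: "real^'n::finite \<Rightarrow> real"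
  assumes f: "C_k 2 f" and h: "0 < h"
  obtains \<xi> \<eta> where "0 < \<xi>" "\<xi> < h" "0 < \<eta>" "\<eta> < h"
    "f (x + h *\<^sub>R axis i 1 + h *\<^sub>R axis j 1) - f (x + h *\<^sub>R axis i 1) - f (x + h *\<^sub>R axis j 1) + f x
      = h^2 * partial j (partial i f) (x + \<xi> *\<^sub>R axis i 1 + \<eta> *\<^sub>R axis j 1)"
proof -
  let ?a = "axis i (1::real) :: real^'n" and ?b = "axis j (1::real) :: real^'n"
  have df: "f differentiable (at y)" and dpf: "partial i f differentiable (at y)" for y
    using f by (auto simp: numeral_2_eq_2 differentiable_on_def)
  define g where "g = (\<lambda>s. f ((x + h *\<^sub>R ?b) + s *\<^sub>R ?a) - f (x + s *\<^sub>R ?a))"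
  have "(g has_field_derivative partial i f ((x + h *\<^sub>R ?b) + s *\<^sub>R ?a) - partial i f (x + s *\<^sub>R ?a)) (at s)" for s
    unfolding g_def by (intro DERIV_diff has_field_derivative_along_axis df)
  from MVT2[OF h this] obtain \<xi> where xi: "0 < \<xi>" "\<xi> < h"
    "g h - g 0 = h * (partial i f ((x + h *\<^sub>R ?b) + \<xi> *\<^sub>R ?a) - partial i f (x + \<xi> *\<^sub>R ?a))"
    by auto
  from MVT2[OF h has_field_derivative_along_axis[OF dpf], of "x + \<xi> *\<^sub>R ?a" j]
  obtain \<eta> where eta: "0 < \<eta>" "\<eta> < h"
    "partial i f (x + \<xi> *\<^sub>R ?a + h *\<^sub>R ?b) - partial i f (x + \<xi> *\<^sub>R ?a)
      = h * partial j (partial i f) (x + \<xi> *\<^sub>R ?a + \<eta> *\<^sub>R ?b)"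
    by auto
  show thesis
    using xi eta by (intro that[of \<xi> \<eta>]) (auto simp: g_def algebra_simps power2_eq_square)
qed

lemma partial_commute_real:
  fixes f :: "real^'n::finite \<Rightarrow> real"
  assumes f: "C_k 2 f"
  shows "partial i (partial j f) x = partial j (partial i f) x"
proof -
  let ?a = "axis i (1::real) :: real^'n" and ?b = "axis j (1::real) :: real^'n"
  have cont: "isCont (partial i (partial j f)) x" "isCont (partial j (partial i f)) x"
    using f by (auto simp: numeral_2_eq_2 continuous_on_eq_continuous_at)
  define h where "h n = inverse (real (Suc n))" for n
  have h: "0 < h n" for n by (simp add: h_def)
  have h0: "h \<longlonglongrightarrow> 0"
    unfolding h_def by (rule LIMSEQ_inverse_real_of_nat)
  define D where "D n = f (x + h n *\<^sub>R ?a + h n *\<^sub>R ?b) - f (x + h n *\<^sub>R ?a) - f (x + h n *\<^sub>R ?b) + f x" for n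
  have "\<exists>s t. 0 < s \<and> s < h n \<and> 0 < t \<and> t < h n \<and>
      D n = (h n)^2 * partial j (partial i f) (x + s *\<^sub>R ?a + t *\<^sub>R ?b)" for n
    using second_difference_mean_value[OF f h, of n x i j] unfolding D_def by metis
  then obtain s t where st: "\<And>n. 0 < s n" "\<And>n. s n < h n" "\<And>n. 0 < t n" "\<And>n. t n < h n"
    "\<And>n. D n = (h n)^2 * partial j (partial i f) (x + s n *\<^sub>R ?a + t n *\<^sub>R ?b)"
    by metis
  have "\<exists>s t. 0 < s \<and> s < h n \<and> 0 < t \<and> t < h n \<and>
      D n = (h n)^2 * partial i (partial j f) (x + s *\<^sub>R ?b + t *\<^sub>R ?a)" for n
    using second_difference_mean_value[OF f h, of n x j i] unfolding D_def
    by (smt (verit, best) add.assoc add.commute)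
  then obtain s' t' where st': "\<And>n. 0 < s' n" "\<And>n. s' n < h n" "\<And>n. 0 < t' n" "\<And>n. t' n < h n"
    "\<And>n. D n = (h n)^2 * partial i (partial j f) (x + s' n *\<^sub>R ?b + t' n *\<^sub>R ?a)"
    by metis
  have lim0: "s \<longlonglongrightarrow> 0" "t \<longlonglongrightarrow> 0" "s' \<longlonglongrightarrow> 0" "t' \<longlonglongrightarrow> 0"
    by (rule tendsto_sandwich[OF _ _ tendsto_const h0]; use st st' in \<open>auto intro!: always_eventually less_imp_le\<close>)+
  have "(\<lambda>n. x + s n *\<^sub>R ?a + t n *\<^sub>R ?b) \<longlonglongrightarrow> x + 0 *\<^sub>R ?a + 0 *\<^sub>R ?b"
    "(\<lambda>n. x + s' n *\<^sub>R ?b + t' n *\<^sub>R ?a) \<longlonglongrightarrow> x + 0 *\<^sub>R ?b + 0 *\<^sub>R ?a"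
    by (intro tendsto_intros lim0)+
  then have "(\<lambda>n. x + s n *\<^sub>R ?a + t n *\<^sub>R ?b) \<longlonglongrightarrow> x"
    "(\<lambda>n. x + s' n *\<^sub>R ?b + t' n *\<^sub>R ?a) \<longlonglongrightarrow> x" by auto
  then have "(\<lambda>n. partial j (partial i f) (x + s n *\<^sub>R ?a + t n *\<^sub>R ?b)) \<longlonglongrightarrow> partial j (partial i f) x"
    "(\<lambda>n. partial i (partial j f) (x + s' n *\<^sub>R ?b + t' n *\<^sub>R ?a)) \<longlonglongrightarrow> partial i (partial j f) x"
    using cont by (auto intro: isCont_tendsto_compose)
  moreover have "partial j (partial i f) (x + s n *\<^sub>R ?a + t n *\<^sub>R ?b) =
      partial i (partial j f) (x + s' n *\<^sub>R ?b + t' n *\<^sub>R ?a)" for n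
    using st(5)[of n] st'(5)[of n] h[of n] by simp
  ultimately show ?thesis
    using LIMSEQ_unique by auto
qed

lemma partial_vec_nth:
  assumes "f differentiable (at x)"
  shows "partial i (\<lambda>y. f y $ k) x = partial i f x $ k"
  using partial_bounded_linear[OF bounded_linear_vec_nth assms] by simp

lemma partial_commute:
  fixes f :: "real^'n::finite \<Rightarrow> real^'m::finite"
  assumes f: "C_k 2 f"
  shows "partial i (partial j f) x = partial j (partial i f) x"
proof -
  have df: "f differentiable (at y)" "partial i f differentiable (at y)" for i y
    using f by (auto simp: numeral_2_eq_2 differentiable_on_def)
  have p: "partial i (\<lambda>y. f y $ k) = (\<lambda>y. partial i f y $ k)" for i k
    by (intro ext partial_vec_nth df)
  have "C_k 2 (\<lambda>y. f y $ k)" for k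
    using C_k_bounded_linear[OF bounded_linear_vec_nth f] .
  from partial_commute_real[OF this, of i j _ x] show ?thesis
    by (simp add: vec_eq_iff p partial_vec_nth df)
qed

section \<open>Integration by parts for functions of bounded support\<close>

lemma integrable_continuous_bounded_support:
  fixes f :: "'a::euclidean_space \<Rightarrow> real"
  assumes "continuous_on UNIV f" "\<And>x. r < norm x \<Longrightarrow> f x = 0"
  shows "integrable lborel f"
proof -
  have "integrable lborel (\<lambda>x. indicator (cball 0 r) x *\<^sub>R f x)"
    using assms(1) by (intro borel_integrable_compact) (auto intro: continuous_on_subset)
  moreover have "(\<lambda>x. indicator (cball 0 r) x *\<^sub>R f x) = f"
    using assms(2) by (auto simp: indicator_def fun_eq_iff)
  ultimately show ?thesis by simp
qed

lemma
  fixes f :: "'a::euclidean_space \<Rightarrow> real"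
  shows integrable_lborel_translate: "integrable lborel f \<Longrightarrow> integrable lborel (\<lambda>x. f (c + x))"
    and integral_lborel_translate: "f \<in> borel_measurable borel \<Longrightarrow> (LINT x|lborel. f (c + x)) = (LINT x|lborel. f x)"
proof -
  assume f: "integrable lborel f"
  then have "integrable (distr lborel borel ((+) c)) f"
    by (simp add: lborel_distr_plus)
  then show "integrable lborel (\<lambda>x. f (c + x))"
    by (subst (asm) integrable_distr_eq) (use f in \<open>auto dest: borel_measurable_integrable\<close>)
next
  assume f: "f \<in> borel_measurable borel"
  have "(LINT x|distr lborel borel ((+) c). f x) = (LINT x|lborel. f (c + x))"
    by (rule integral_distr) (use f in simp_all)
  then show "(LINT x|lborel. f (c + x)) = (LINT x|lborel. f x)"
    unfolding lborel_distr_plus by simp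
qed

text \<open>Each difference quotient \<open>(f (x + h e\<^sub>i) - f x) / h\<close> has
  integral zero by translation invariance, and the quotients converge to the partial derivative,
  dominated by a constant on a ball.\<close>

lemma integral_partial_eq_0:
  fixes f :: "real^'n::finite \<Rightarrow> real"
  assumes C1: "C_k 1 f" and supp: "\<And>x. r < norm x \<Longrightarrow> f x = 0"
  shows "(LINT x|lborel. partial i f x) = 0"
proof -
  let ?e = "axis i (1::real) :: real^'n"
  have df: "f differentiable (at x)" for x
    using C1 by (auto simp: differentiable_on_def)
  have cf: "continuous_on UNIV f" and cp: "continuous_on UNIV (partial i f)"
    using C1 C_k_continuous[OF C1] by auto
  have int_f: "integrable lborel f"
    using cf supp by (rule integrable_continuous_bounded_support)
  have bm: "f \<in> borel_measurable borel" "partial i f \<in> borel_measurable borel"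
    using cf cp by (auto intro: borel_measurable_continuous_onI)
  have "bounded (partial i f ` cball 0 (r + 2))"
    by (intro compact_imp_bounded compact_continuous_image continuous_on_subset[OF cp]) auto
  then obtain B where B: "\<And>x. norm x \<le> r + 2 \<Longrightarrow> \<bar>partial i f x\<bar> \<le> B"
    unfolding bounded_iff by (metis image_eqI mem_cball_0 real_norm_def)
  define h where "h n = inverse (real (Suc n))" for n
  have h: "0 < h n" "h n \<le> 1" for n
    by (auto simp: h_def field_simps)
  have h0: "h \<longlonglongrightarrow> 0"
    unfolding h_def by (rule LIMSEQ_inverse_real_of_nat)
  have deriv: "((\<lambda>t. f (x + t *\<^sub>R ?e)) has_real_derivative partial i f (x + t *\<^sub>R ?e)) (at t)" for x t
    by (intro has_field_derivative_along_axis df)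
  define s where "s n x = (f (h n *\<^sub>R ?e + x) - f x) / h n" for n x
  have int_s: "(LINT x|lborel. s n x) = 0" for n
    unfolding s_def using integrable_lborel_translate[OF int_f] int_f integral_lborel_translate[OF bm(1)]
    by simp
  have "(\<lambda>n. LINT x|lborel. s n x) \<longlonglongrightarrow> (LINT x|lborel. partial i f x)"
  proof (rule integral_dominated_convergence[where w = "\<lambda>x. B * indicator (cball 0 (r + 1)) x"])
    show "integrable lborel (\<lambda>x::real^'n. B * indicator (cball 0 (r + 1)) x)"
      using emeasure_lborel_cball_finite[of "0::real^'n" "r + 1"] by simp
    show "s n \<in> borel_measurable lborel" for n
      unfolding s_def using bm by measurable
    show "AE x in lborel. (\<lambda>n. s n x) \<longlonglongrightarrow> partial i f x"
    proof (intro always_eventually allI)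
      fix x
      have "((\<lambda>t. (f (x + t *\<^sub>R ?e) - f x) / t) \<longlongrightarrow> partial i f x) (at 0)"
        using deriv[of x 0] by (simp add: DERIV_def)
      moreover have "filterlim h (at 0) sequentially"
        using h0 h by (auto simp: filterlim_at intro!: always_eventually) (metis less_irrefl)
      ultimately show "(\<lambda>n. s n x) \<longlonglongrightarrow> partial i f x"
        unfolding s_def by (auto dest: filterlim_compose simp: add.commute)
    qed
    show "AE x in lborel. norm (s n x) \<le> B * indicator (cball 0 (r + 1)) x" for n
    proof (intro always_eventually allI)
      fix x
      have dist: "norm (x + t *\<^sub>R ?e) \<le> norm x + 1" "norm (x + t *\<^sub>R ?e) \<ge> norm x - 1"
        if "0 \<le> t" "t \<le> h n" for t
        using that h(2)[of n] norm_triangle_ineq[of x "t *\<^sub>R ?e"] norm_diff_ineq[of x "t *\<^sub>R ?e"] by auto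
      show "norm (s n x) \<le> B * indicator (cball 0 (r + 1)) x"
      proof (cases "norm x \<le> r + 1")
        \<comment> \<open>Steps have length at most 1, so the quotient vanishes outside the ball of radius
          \<open>r + 1\<close>, and inside it only sees the derivative on the ball of radius \<open>r + 2\<close>.\<close>
        case True
        obtain t where t: "0 < t" "t < h n" "f (x + h n *\<^sub>R ?e) - f (x + 0 *\<^sub>R ?e) = (h n - 0) * partial i f (x + t *\<^sub>R ?e)"
          using MVT2[OF h(1)[of n], of "\<lambda>t. f (x + t *\<^sub>R ?e)" "\<lambda>t. partial i f (x + t *\<^sub>R ?e)"]
            deriv by blast
        then have "s n x = partial i f (x + t *\<^sub>R ?e)"
          using h(1)[of n] by (simp add: s_def add.commute)
        then show ?thesis
          using True B[of "x + t *\<^sub>R ?e"] dist[of t] t by auto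
      next
        case False
        then have "f (x + h n *\<^sub>R ?e) = 0" "f x = 0"
          using dist[of "h n"] h[of n] by (auto intro!: supp)
        then show ?thesis
          using False by (simp add: s_def add.commute)
      qed
    qed
  qed (use bm in auto)
  then show ?thesis
    by (simp add: int_s LIMSEQ_const_iff)
qed

lemma partial_eq_0_outside:
  fixes f :: "real^'n::finite \<Rightarrow> real"
  assumes supp: "\<And>x. r < norm x \<Longrightarrow> f x = 0" and x: "r < norm x"
  shows "partial i f x = 0"
proof -
  have "open {x::real^'n. r < norm x}"
    by (intro open_Collect_less continuous_intros)
  then have "(f has_derivative (\<lambda>_. 0)) (at x)"
    using x supp by (intro has_derivative_transform_within_open[OF has_derivative_const[of 0]]) auto
  from partial_eqI[OF this] show ?thesis .
qed

lemma integral_by_parts: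
  fixes f g :: "real^'n::finite \<Rightarrow> real"
  assumes f: "C_k 1 f" and g: "C_k 1 g" and supp: "\<And>x. r < norm x \<Longrightarrow> f x = 0"
  shows "integrable lborel (\<lambda>x. f x * partial i g x)"
    and "integrable lborel (\<lambda>x. partial i f x * g x)"
    and "(LINT x|lborel. f x * partial i g x) = - (LINT x|lborel. partial i f x * g x)"
proof -
  have diff: "f differentiable (at x)" "g differentiable (at x)" for x
    using f g by (auto simp: differentiable_on_def)
  have cont: "continuous_on UNIV f" "continuous_on UNIV g"
      "continuous_on UNIV (partial i f)" "continuous_on UNIV (partial i g)"
    using C_k_continuous[OF f] C_k_continuous[OF g] f g by auto
  note supp' = partial_eq_0_outside[OF supp]
  show 1: "integrable lborel (\<lambda>x. f x * partial i g x)" "integrable lborel (\<lambda>x. partial i f x * g x)"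
    using supp supp' cont
    by (auto intro!: integrable_continuous_bounded_support[where r = r] continuous_intros)
  have p: "partial i (\<lambda>y. f y * g y) = (\<lambda>x. f x * partial i g x + partial i f x * g x)"
    by (intro ext partial_bounded_bilinear bounded_bilinear_mult diff)
  have "C_k 1 (\<lambda>y. f y * g y)"
    by (intro C_k_bounded_bilinear[OF bounded_bilinear_mult] f g)
  from integral_partial_eq_0[OF this, of r i] supp
  have "(LINT x|lborel. f x * partial i g x + partial i f x * g x) = 0"
    by (simp add: p)
  with 1 show "(LINT x|lborel. f x * partial i g x) = - (LINT x|lborel. partial i f x * g x)"
    by simp
qed

lemma C_k_2D:
  assumes "C_k 2 f"
  shows "C_k 1 f" "C_k 1 (partial i f)"
  using assms C_k_SucD[of 1 f] C_k_partial[of 1 f] unfolding Suc_1 by blast+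

text \<open>The weak form of \<open>\<Delta>u = div F\<close>: all derivatives are moved to the test function \<open>\<phi>\<close>.\<close>

lemma integral_laplacian_eq_divergence:
  fixes \<phi> u :: "real^'n::finite \<Rightarrow> real" and F :: "real^'n \<Rightarrow> real^'n"
  assumes phi: "C_k 2 \<phi>" and u: "C_k 2 u" and F: "C_k 1 F"
    and supp: "\<And>x. r < norm x \<Longrightarrow> \<phi> x = 0"
    and eq: "\<And>x. laplacian u x = divergence F x"
  shows "(LINT x|lborel. laplacian \<phi> x * u x) = - (LINT x|lborel. grad \<phi> x \<bullet> F x)"
proof -
  have 1: "C_k 1 \<phi>" "C_k 1 u" "C_k 1 (partial i \<phi>)" "C_k 1 (partial i u)" "C_k 1 (\<lambda>x. F x $ i)" for i
    by (intro C_k_2D phi u C_k_bounded_linear[OF bounded_linear_vec_nth] F)+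
  note supp' = partial_eq_0_outside[OF supp]
  note p1 = integral_by_parts[OF 1(1,4) supp] and p2 = integral_by_parts[OF 1(3,2) supp']
    and p3 = integral_by_parts[OF 1(1,5) supp]
  have c: "(LINT x|lborel. \<phi> x * partial i (\<lambda>y. F y $ i) x) = - (LINT x|lborel. partial i \<phi> x * F x $ i)" for i
    by (rule p3(3))
  have a: "(LINT x|lborel. \<phi> x * partial i (partial i u) x) = - (LINT x|lborel. partial i \<phi> x * partial i u x)" for i
    by (rule integral_by_parts(3)[OF 1(1,4) supp])
  have b: "(LINT x|lborel. partial i \<phi> x * partial i u x) = - (LINT x|lborel. partial i (partial i \<phi>) x * u x)" for i
    by (rule integral_by_parts(3)[OF 1(3,2) supp'])
  have "(LINT x|lborel. laplacian \<phi> x * u x) = (\<Sum>i\<in>UNIV. LINT x|lborel. partial i (partial i \<phi>) x * u x)"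
    unfolding laplacian_def sum_distrib_right by (intro Bochner_Integration.integral_sum p2(2))
  also have "\<dots> = (\<Sum>i\<in>UNIV. LINT x|lborel. \<phi> x * partial i (partial i u) x)"
    by (simp only: a b minus_minus)
  also have "\<dots> = (LINT x|lborel. \<phi> x * laplacian u x)"
    unfolding laplacian_def sum_distrib_left
    by (intro Bochner_Integration.integral_sum[symmetric] p1(1))
  also have "\<dots> = (\<Sum>i\<in>UNIV. LINT x|lborel. \<phi> x * partial i (\<lambda>y. F y $ i) x)"
    unfolding eq divergence_def sum_distrib_left by (intro Bochner_Integration.integral_sum p3(1))
  also have "\<dots> = - (LINT x|lborel. grad \<phi> x \<bullet> F x)"
    by (simp add: inner_vec_def grad_def c sum_negf Bochner_Integration.integral_sum[OF p3(2)])
  finally show ?thesis .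
qed

section \<open>The regularised Coulomb potential\<close>

lemma partial_radial:
  fixes g g' :: "real \<Rightarrow> real"
  assumes "\<And>s. (g has_real_derivative g' s) (at s)"
  shows "partial i (\<lambda>z::real^'n::finite. g (z \<bullet> z)) z = 2 * g' (z \<bullet> z) * z $ i"
    and "(\<lambda>z::real^'n. g (z \<bullet> z)) differentiable (at z)"
proof -
  have "((\<lambda>z::real^'n. g (z \<bullet> z)) has_derivative (\<lambda>h. g' (z \<bullet> z) * (z \<bullet> h + h \<bullet> z))) (at z)"
    using has_derivative_compose[OF has_derivative_inner[OF has_derivative_ident has_derivative_ident]
        assms[unfolded has_field_derivative_def], of z UNIV]
    by (simp add: add.commute)
  then show "partial i (\<lambda>z::real^'n. g (z \<bullet> z)) z = 2 * g' (z \<bullet> z) * z $ i"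
      "(\<lambda>z::real^'n. g (z \<bullet> z)) differentiable (at z)"
    using partial_eqI by (fastforce simp: inner_axis inner_axis' algebra_simps, blast intro: differentiableI)
qed

lemma C_1_radial:
  fixes g g' :: "real \<Rightarrow> real"
  assumes "\<And>s. (g has_real_derivative g' s) (at s)" "continuous_on UNIV g'"
  shows "C_k 1 (\<lambda>z::real^'n::finite. g (z \<bullet> z))"
proof -
  have "partial i (\<lambda>z::real^'n. g (z \<bullet> z)) = (\<lambda>z. 2 * g' (z \<bullet> z) * z $ i)" for i
    by (intro ext partial_radial assms)
  moreover have "continuous_on UNIV (\<lambda>z::real^'n. 2 * g' (z \<bullet> z) * z $ i)" for i
    by (intro continuous_intros continuous_on_compose2[OF assms(2)]) auto
  ultimately show ?thesis
    using partial_radial(2)[OF assms(1)] by (auto simp: differentiable_on_def)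
qed

lemma C_k_linear: "bounded_linear L \<Longrightarrow> C_k 1 L"
  and partial_linear: "bounded_linear L \<Longrightarrow> partial i L x = L (axis i 1)"
proof -
  assume L: "bounded_linear L"
  then have p: "partial i L x = L (axis i 1)" for i x
    by (intro partial_eqI bounded_linear_imp_has_derivative)
  then show "partial i L x = L (axis i 1)" .
  have "partial i L = (\<lambda>_. L (axis i 1))" for i
    using p by auto
  moreover have "L differentiable (at x)" for x
    using L bounded_linear_imp_differentiable by blast
  ultimately show "C_k 1 L" by (auto simp: differentiable_on_def)
qed

lemma
  fixes g g' g'' :: "real \<Rightarrow> real"
  assumes g: "\<And>s. (g has_real_derivative g' s) (at s)" "\<And>s. (g' has_real_derivative g'' s) (at s)"
    and c: "continuous_on UNIV g''"
  shows C_2_radial: "C_k 2 (\<lambda>z::real^'n::finite. g (z \<bullet> z))"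
    and laplacian_radial: "laplacian (\<lambda>z::real^'n. g (z \<bullet> z)) z
      = 2 * real CARD('n) * g' (z \<bullet> z) + 4 * (z \<bullet> z) * g'' (z \<bullet> z)"
proof -
  have p: "partial i (\<lambda>z::real^'n. g (z \<bullet> z)) = (\<lambda>z. (2 * g' (z \<bullet> z)) * z $ i)" for i
    by (intro ext partial_radial g)
  have g2: "((\<lambda>s. 2 * g' s) has_real_derivative 2 * g'' s) (at s)" for s
    by (intro DERIV_cmult g)
  have c2: "continuous_on UNIV (\<lambda>s. 2 * g'' s)"
    by (intro continuous_intros c)
  have lin: "C_k 1 (\<lambda>z::real^'n. z $ i)" for i
    by (rule C_k_linear[OF bounded_linear_vec_nth])
  have C1: "C_k 1 (\<lambda>z::real^'n. (2 * g' (z \<bullet> z)) * z $ i)" for i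
    by (rule C_k_bounded_bilinear[OF bounded_bilinear_mult C_1_radial[OF g2 c2] lin])
  then show "C_k 2 (\<lambda>z::real^'n. g (z \<bullet> z))"
    using partial_radial(2)[OF g(1)] by (auto simp: numeral_2_eq_2 p differentiable_on_def)
  have "partial i (\<lambda>z::real^'n. (2 * g' (z \<bullet> z)) * z $ i) z = 2 * g' (z \<bullet> z) + 4 * (z $ i * z $ i) * g'' (z \<bullet> z)" for i
  proof -
    have "(\<lambda>z::real^'n. z $ i) differentiable (at z)"
      using lin[of i] by (simp add: differentiable_on_def)
    from partial_bounded_bilinear[OF bounded_bilinear_mult partial_radial(2)[OF g2] this, of i]
    show ?thesis
      unfolding partial_radial(1)[OF g2] partial_linear[OF bounded_linear_vec_nth] by simp
  qed
  then show "laplacian (\<lambda>z::real^'n. g (z \<bullet> z)) z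
      = 2 * real CARD('n) * g' (z \<bullet> z) + 4 * (z \<bullet> z) * g'' (z \<bullet> z)"
    unfolding laplacian_def p
    by (simp add: sum.distrib flip: sum_distrib_left sum_distrib_right) (simp add: inner_vec_def)
qed

lemma has_real_derivative_piecewise:
  fixes f g :: "real \<Rightarrow> real"
  assumes f: "\<And>s. s \<le> a \<Longrightarrow> (f has_real_derivative f' s) (at s)"
    and g: "\<And>s. a \<le> s \<Longrightarrow> (g has_real_derivative g' s) (at s)"
    and eq: "f a = g a" "f' a = g' a"
  shows "((\<lambda>s. if s \<le> a then f s else g s) has_real_derivative (if s \<le> a then f' s else g' s)) (at s)"
proof -
  have "((\<lambda>s. if s \<in> {..a} then f s else g s) has_vector_derivative (if s \<in> {..a} then f' s else g' s)) (at s within UNIV)"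
    by (rule has_vector_derivative_If_within_closures[where T = "{a<..}"])
      (use f g eq in \<open>auto simp flip: has_real_derivative_iff_has_vector_derivative
        intro: has_field_derivative_at_within\<close>)
  then show ?thesis
    by (simp add: has_real_derivative_iff_has_vector_derivative)
qed

text \<open>The profile of \<open>1 / |z|\<close> as a function of \<open>s = |z|^2\<close>, continued below \<open>s = 1\<close> by its Taylor
  polynomial of degree two at \<open>s = 1\<close>. This is the lowest degree that keeps the profile \<open>C^2\<close>. The
  next two functions are its first and second derivative.\<close>

definition coulomb :: "real \<Rightarrow> real" where
  "coulomb s = (if s \<le> 1 then 1 - (s - 1) / 2 + 3 / 8 * (s - 1)^2 else s powr (-1/2))"

definition coulomb' :: "real \<Rightarrow> real" where
  "coulomb' s = (if s \<le> 1 then - 1 / 2 + 3 / 4 * (s - 1) else - 1 / 2 * s powr (-3/2))"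

definition coulomb'' :: "real \<Rightarrow> real" where
  "coulomb'' s = (if s \<le> 1 then 3 / 4 else 3 / 4 * s powr (-5/2))"

lemma has_derivative_coulomb: "(coulomb has_real_derivative coulomb' s) (at s)"
proof -
  have "((\<lambda>s. if s \<le> 1 then 1 - (s - 1) / 2 + 3 / 8 * (s - 1)^2 else s powr (-1/2)) has_real_derivative
      (if s \<le> 1 then - 1 / 2 + 3 / 4 * (s - 1) else - 1 / 2 * s powr (-3/2))) (at s)"
    by (rule has_real_derivative_piecewise)
      (auto intro!: derivative_eq_intros has_real_derivative_powr[of _ "-1/2", THEN DERIV_cong] simp: field_simps)
  then show ?thesis
    by (simp add: coulomb_def[abs_def] coulomb'_def)
qed

lemma has_derivative_coulomb': "(coulomb' has_real_derivative coulomb'' s) (at s)"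
proof -
  have "((\<lambda>s. if s \<le> 1 then - 1 / 2 + 3 / 4 * (s - 1) else - 1 / 2 * s powr (-3/2)) has_real_derivative
      (if s \<le> 1 then 3 / 4 else - 1 / 2 * (-3/2 * s powr (-5/2)))) (at s)"
    by (rule has_real_derivative_piecewise)
      (auto intro!: derivative_eq_intros DERIV_cmult has_real_derivative_powr[of _ "-3/2", THEN DERIV_cong] simp: field_simps)
  then show ?thesis
    unfolding coulomb'_def[abs_def] coulomb''_def by (simp cong: if_cong)
qed

lemma continuous_coulomb'': "continuous_on UNIV coulomb''"
proof -
  have "continuous_on ({..1} \<union> {1..}) (\<lambda>s::real. if s \<le> 1 then 3 / 4 else 3 / 4 * s powr (-5/2))"
    by (intro continuous_on_If continuous_intros) auto
  moreover have "{..1} \<union> {1..} = (UNIV :: real set)" by auto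
  ultimately show ?thesis
    by (simp add: coulomb''_def[abs_def])
qed

text \<open>The left-hand side is the Laplacian in three dimensions of \<open>coulomb (|z|^2)\<close> at \<open>|z|^2 = s\<close>. It
  vanishes beyond the core because \<open>1 / |z|\<close> is harmonic, and it has a sign inside the core.\<close>

lemma coulomb_ode:
  "6 * coulomb' s + 4 * s * coulomb'' s = - 15 / 2 * max 0 (1 - s)"
proof (cases "s \<le> 1")
  case False
  then have "s powr (-3/2) = s * s powr (-5/2)"
    using powr_mult_base[of s "-5/2"] by simp
  then show ?thesis using False by (simp add: coulomb'_def coulomb''_def)
qed (simp add: coulomb'_def coulomb''_def field_simps)

text \<open>The functions \<open>G_r\<close> (\<open>potential\<close>), \<open>- \<Delta>G_r\<close> (\<open>bump\<close>) and the coefficient in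
  \<open>\<nabla>G_r = - kern r z *\<^sub>R z\<close>.\<close>

definition kern :: "real \<Rightarrow> real^3 \<Rightarrow> real" where
  "kern r z = - 2 * coulomb' (z \<bullet> z / r^2) / r^3"

definition bump :: "real \<Rightarrow> real^3 \<Rightarrow> real" where
  "bump r z = 15 / 2 * max 0 (1 - z \<bullet> z / r^2) / r^3"

definition potential :: "real \<Rightarrow> real^3 \<Rightarrow> real" where
  "potential r z = coulomb (z \<bullet> z / r^2) / r"

lemma
  assumes r: "0 < r"
  shows C_2_potential: "C_k 2 (potential r)"
    and partial_potential: "partial i (potential r) z = - kern r z * z $ i"
    and laplacian_potential: "laplacian (potential r) z = - bump r z"
    and potential_far: "r \<le> norm z \<Longrightarrow> potential r z = 1 / norm z"
proof -
  let ?g = "\<lambda>s. coulomb (s / r^2) / r" and ?g' = "\<lambda>s. coulomb' (s / r^2) / r^3" and ?g'' = "\<lambda>s. coulomb'' (s / r^2) / r^5"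
  have 1: "(?g has_real_derivative ?g' s) (at s)" for s
    using r by (auto intro!: derivative_eq_intros DERIV_chain2[OF has_derivative_coulomb] simp: field_simps eval_nat_numeral)
  have 2: "(?g' has_real_derivative ?g'' s) (at s)" for s
    using r by (auto intro!: derivative_eq_intros DERIV_chain2[OF has_derivative_coulomb'] simp: field_simps eval_nat_numeral)
  have 3: "continuous_on UNIV ?g''"
    using r by (intro continuous_intros continuous_on_compose2[OF continuous_coulomb'']) auto
  have p: "potential r = (\<lambda>z. ?g (z \<bullet> z))"
    by (simp add: fun_eq_iff potential_def)
  show "C_k 2 (potential r)"
    unfolding p by (rule C_2_radial[OF 1 2 3])
  show "partial i (potential r) z = - kern r z * z $ i"
    unfolding p by (subst partial_radial[OF 1]) (simp add: kern_def)
  have "laplacian (potential r) z = (6 * coulomb' (z \<bullet> z / r^2) + 4 * (z \<bullet> z / r^2) * coulomb'' (z \<bullet> z / r^2)) / r^3"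
    unfolding p by (subst laplacian_radial[OF 1 2 3]) (use r in \<open>simp add: field_simps eval_nat_numeral\<close>)
  then show "laplacian (potential r) z = - bump r z"
    by (simp only: coulomb_ode) (simp add: bump_def)
  assume z: "r \<le> norm z"
  then have "r^2 \<le> z \<bullet> z"
    using r by (metis less_imp_le power2_norm_eq_inner power_mono)
  then have "coulomb (z \<bullet> z / r^2) = (z \<bullet> z / r^2) powr (-1/2)"
    using r by (auto simp: coulomb_def)
  also have "\<dots> = 1 / sqrt (z \<bullet> z / r^2)"
    using powr_half_sqrt[of "z \<bullet> z / r^2"] by (simp add: powr_minus_divide)
  also have "\<dots> = r / norm z"
    using r by (simp add: real_sqrt_divide norm_eq_sqrt_inner)
  finally show "potential r z = 1 / norm z"
    using r by (simp add: potential_def)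
qed

text \<open>The potentials \<open>G_\<epsilon>\<close> and \<open>G_R\<close> both equal \<open>1 / |z|\<close> for \<open>|z| \<ge> R\<close>, so their difference is an
  admissible test function.\<close>

lemma integral_bump_kern:
  fixes u :: "real^3 \<Rightarrow> real" and F :: "real^3 \<Rightarrow> real^3"
  assumes u: "C_k 2 u" and F: "C_k 1 F" and eq: "\<And>x. laplacian u x = divergence F x"
    and eps: "0 < \<epsilon>" "\<epsilon> \<le> R"
  shows "(LINT z|lborel. (bump \<epsilon> z - bump R z) * u z) = - (LINT z|lborel. (kern \<epsilon> z - kern R z) * (z \<bullet> F z))"
proof -
  define \<phi> where "\<phi> = (\<lambda>z. potential R z + (- 1) * potential \<epsilon> z)"
  have R: "0 < R" using eps by simp
  note [simp] = C_2_potential[OF R] C_2_potential[OF eps(1)]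
  have C: "C_k 2 \<phi>"
    unfolding \<phi>_def by (intro C_k_add C_k_bounded_linear[OF bounded_linear_mult_right]) auto
  have d: "potential r differentiable at z" "partial i (potential r) differentiable at z" if "0 < r" for r i z
    using C_2_potential[OF that] by (auto simp: numeral_2_eq_2 differentiable_on_def)
  have d': "(\<lambda>z. (- 1) * potential \<epsilon> z) differentiable at z" "(\<lambda>z. (- 1) * partial i (potential \<epsilon>) z) differentiable at z" for i z
    by (intro differentiable_mult differentiable_const d eps)+
  have p: "partial i \<phi> = (\<lambda>z. partial i (potential R) z + (- 1) * partial i (potential \<epsilon>) z)" for i
    unfolding \<phi>_def
    by (intro ext, subst partial_add, (intro d d' R)+, subst partial_bounded_linear[OF bounded_linear_mult_right d(1)[OF eps(1)]], rule refl)
  have grad: "grad \<phi> z = (kern \<epsilon> z - kern R z) *\<^sub>R z" for z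
    by (simp add: grad_def vec_eq_iff p partial_potential eps R algebra_simps)
  have "partial i (partial i \<phi>) z = partial i (partial i (potential R)) z + (- 1) * partial i (partial i (potential \<epsilon>)) z" for i z
    unfolding p
    by (subst partial_add, (intro d d' R)+, subst partial_bounded_linear[OF bounded_linear_mult_right d(2)[OF eps(1)]], rule refl)
  then have lap: "laplacian \<phi> z = laplacian (potential R) z + (- 1) * laplacian (potential \<epsilon>) z" for z
    by (simp add: laplacian_def sum.distrib sum_negf sum_subtractf)
  have "\<phi> z = 0" if "R < norm z" for z
    using that eps R by (simp add: \<phi>_def potential_far)
  from integral_laplacian_eq_divergence[OF C u F this eq]
  show ?thesis
    by (simp add: lap grad laplacian_potential eps R)
qed

section \<open>Limits of the regularised kernels\<close>

lemma kern_far: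
  assumes "0 < r" "r \<le> norm z"
  shows "kern r z = 1 / norm z ^ 3"
proof -
  have s: "1 \<le> z \<bullet> z / r^2"
    using assms by (simp add: power_mono flip: power2_norm_eq_inner)
  have "z \<bullet> z / r^2 = (norm z / r) powr 2"
    using assms by (simp add: power_divide flip: power2_norm_eq_inner)
  then have "(z \<bullet> z / r^2) powr (-3/2) = (norm z / r) powr (-3)"
    by (simp add: powr_powr)
  also have "\<dots> = (r / norm z)^3"
    using assms by (simp add: powr_minus_divide powr_numeral power_divide)
  moreover have "coulomb' (z \<bullet> z / r^2) = - 1 / 2 * (z \<bullet> z / r^2) powr (-3/2)"
    using s by (auto simp: coulomb'_def)
  ultimately show ?thesis
    using assms by (simp add: kern_def power_divide)
qed

lemma kern_near:
  assumes "0 < r" "norm z \<le> r"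
  shows "0 \<le> kern r z" "kern r z \<le> (5 / 2) / r^3"
proof -
  have s: "z \<bullet> z / r^2 \<le> 1" "0 \<le> z \<bullet> z / r^2"
    using assms by (simp_all add: power_mono flip: power2_norm_eq_inner)
  then have "0 \<le> - 2 * coulomb' (z \<bullet> z / r^2)" "- 2 * coulomb' (z \<bullet> z / r^2) \<le> 5 / 2"
    unfolding coulomb'_def by argo+
  then show "0 \<le> kern r z" "kern r z \<le> (5 / 2) / r^3"
    unfolding kern_def using assms by (intro divide_nonneg_pos divide_right_mono; simp)+
qed

text \<open>The last bound is uniform in \<open>r\<close> and provides the dominating function for both limits, the
  second one makes the kernel vanish in the limit \<open>r \<rightarrow> \<infinity>\<close>.\<close>

lemma kern_bounds:
  assumes r: "0 < r"
  shows "0 \<le> kern r z" "kern r z \<le> (5 / 2) / r^3" "z \<noteq> 0 \<Longrightarrow> kern r z \<le> (5 / 2) / norm z^3"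
proof -
  consider "norm z \<le> r" | "r \<le> norm z" by linarith
  then have "0 \<le> kern r z \<and> kern r z \<le> (5 / 2) / r^3 \<and> (z \<noteq> 0 \<longrightarrow> kern r z \<le> (5 / 2) / norm z^3)"
  proof cases
    case 1
    then have "(5 / 2) / r^3 \<le> (5 / 2) / norm z^3" if "z \<noteq> 0"
      using that r by (intro frac_le power_mono) auto
    with kern_near[OF r 1] show ?thesis by auto
  next
    case 2
    then have "1 / norm z ^ 3 \<le> (5 / 2) / r^3"
      using r by (intro frac_le power_mono) auto
    moreover have "1 / norm z ^ 3 \<le> (5 / 2) / norm z ^ 3"
      by (intro divide_right_mono) auto
    ultimately show ?thesis using kern_far[OF r 2] by simp
  qed
  then show "0 \<le> kern r z" "kern r z \<le> (5 / 2) / r^3" "z \<noteq> 0 \<Longrightarrow> kern r z \<le> (5 / 2) / norm z^3"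
    by auto
qed

lemma continuous_kern: "continuous_on UNIV (kern r)"
proof -
  have "continuous_on UNIV coulomb'"
    by (rule DERIV_continuous_on) (rule has_derivative_coulomb')
  then have "continuous_on UNIV (\<lambda>z::real^3. coulomb' (z \<bullet> z / r^2))"
    by (rule continuous_on_compose2) (auto simp: divide_inverse intro!: continuous_intros)
  then show ?thesis
    unfolding kern_def[abs_def] divide_inverse by (intro continuous_intros)
qed

lemma continuous_bump: "continuous_on UNIV (bump r)"
  unfolding bump_def[abs_def] divide_inverse by (intro continuous_intros)

lemma bump_bounds:
  assumes "0 < r"
  shows "0 \<le> bump r z" "bump r z \<le> (15 / 2) / r^3"
  using assms by (auto simp: bump_def intro!: divide_right_mono)

lemma bump_eq_0:
  assumes "0 < r" "r < norm z"
  shows "bump r z = 0"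
proof -
  have "1 \<le> z \<bullet> z / r^2"
    using assms by (simp add: power_mono flip: power2_norm_eq_inner)
  then show ?thesis by (simp add: bump_def)
qed

lemma integrable_bump_mult:
  assumes "0 < r" "continuous_on UNIV u"
  shows "integrable lborel (\<lambda>z. bump r z * u z)"
  by (rule integrable_continuous_bounded_support[where r = r])
    (auto intro!: continuous_intros continuous_bump assms simp: bump_eq_0 assms)

lemma integral_lborel_scale:
  fixes f :: "'a::euclidean_space \<Rightarrow> real"
  assumes "0 < c" and f: "f \<in> borel_measurable borel"
  shows "(LINT x|lborel. f x) = c ^ DIM('a) * (LINT x|lborel. f (c *\<^sub>R x))"
proof -
  have "(LINT x|lborel. f x) = (LINT x|density (distr lborel borel (\<lambda>x. 0 + c *\<^sub>R x)) (\<lambda>_. ennreal (\<bar>c\<bar> ^ DIM('a))). f x)"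
    using lborel_affine[of c "0::'a"] assms by (simp add: ennreal_power)
  also have "\<dots> = (LINT x|distr lborel borel (\<lambda>x. 0 + c *\<^sub>R x). \<bar>c\<bar> ^ DIM('a) * f x)"
    by (subst integral_real_density) (use f in auto)
  also have "\<dots> = (LINT x|lborel. \<bar>c\<bar> ^ DIM('a) * f (0 + c *\<^sub>R x))"
    by (rule integral_distr) (use f in simp_all)
  finally show ?thesis using assms by simp
qed

text \<open>Scaling shows that the mass of the bump does not depend on \<open>r\<close> and reduces the limit \<open>r \<rightarrow> 0\<close> to
  a fixed weight.\<close>

lemma integral_bump_scale:
  assumes r: "0 < r" and u: "continuous_on UNIV u"
  shows "(LINT z|lborel. bump r z * u z) = (LINT z|lborel. bump 1 z * u (r *\<^sub>R z))"
proof -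
  have "(\<lambda>z. bump r z * u z) \<in> borel_measurable borel"
    by (intro borel_measurable_continuous_onI continuous_intros continuous_bump u)
  from integral_lborel_scale[OF r this]
  have "(LINT z|lborel. bump r z * u z) = r^3 * (LINT z|lborel. bump r (r *\<^sub>R z) * u (r *\<^sub>R z))"
    by simp
  also have "\<dots> = (LINT z|lborel. r^3 * (bump r (r *\<^sub>R z) * u (r *\<^sub>R z)))"
    by simp
  also have "\<dots> = (LINT z|lborel. bump 1 z * u (r *\<^sub>R z))"
    using r by (intro Bochner_Integration.integral_cong refl) (simp add: bump_def power2_eq_square)
  finally show ?thesis .
qed

text \<open>The constant \<open>\<kappa>\<close> of the representation formula, which is the total charge \<open>4 \<pi>\<close> of \<open>1 / |z|\<close>.\<close>

definition bump_mass :: real where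
  "bump_mass = (LINT z|lborel. bump 1 z)"

lemma integrable_bump: "0 < r \<Longrightarrow> integrable lborel (bump r)"
  using integrable_bump_mult[of r "\<lambda>_. 1"] by simp

lemma integral_bump: "0 < r \<Longrightarrow> (LINT z|lborel. bump r z) = bump_mass"
  using integral_bump_scale[of r "\<lambda>_. 1"] by (simp add: bump_mass_def)

lemma bump_mass_pos: "0 < bump_mass"
proof -
  have fin: "emeasure lborel (ball (0::real^3) (1 / 2)) < \<infinity>"
    by (rule emeasure_lborel_ball_finite)
  have "0 < measure lborel (ball (0::real^3) (1 / 2))"
    by (rule content_ball_pos) simp
  also have "\<dots> = (LINT z|lborel. indicator (ball (0::real^3) (1 / 2)) z)"
    by simp
  also have "\<dots> \<le> bump_mass"
    unfolding bump_mass_def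
  proof (rule integral_mono)
    show "integrable lborel (indicator (ball (0::real^3) (1 / 2)) :: _ \<Rightarrow> real)"
      using fin by simp
    show "indicator (ball (0::real^3) (1 / 2)) z \<le> bump 1 z" for z
    proof (cases "norm z < 1 / 2")
      case True
      then have "norm z ^ 2 \<le> (1 / 2)^2"
        by (intro power_mono) auto
      then show ?thesis
        by (auto simp: bump_def indicator_def power2_eq_square simp flip: power2_norm_eq_inner)
    qed (auto simp: bump_bounds)
  qed (simp add: integrable_bump)
  finally show ?thesis .
qed

lemma tendsto_integral_bump_at_0:
  assumes "continuous_on UNIV u"
  shows "(\<lambda>n. LINT z|lborel. bump (inverse (real (Suc n))) z * u z) \<longlonglongrightarrow> bump_mass * u 0"
proof -
  define h where "h n = inverse (real (Suc n))" for n
  have h: "0 < h n" "h n \<le> 1" for n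
    by (auto simp: h_def field_simps)
  have h0: "h \<longlonglongrightarrow> 0"
    unfolding h_def by (rule LIMSEQ_inverse_real_of_nat)
  have "bounded (u ` cball 0 1)"
    by (intro compact_imp_bounded compact_continuous_image continuous_on_subset[OF assms]) auto
  then obtain B where B: "\<And>z. norm z \<le> 1 \<Longrightarrow> \<bar>u z\<bar> \<le> B"
    unfolding bounded_iff by (metis image_eqI mem_cball_0 real_norm_def)
  have cu: "continuous_on UNIV (\<lambda>z. u (c *\<^sub>R z))" for c
    by (intro continuous_on_compose2[OF assms] continuous_intros) auto
  have "(\<lambda>n. LINT z|lborel. bump 1 z * u (h n *\<^sub>R z)) \<longlonglongrightarrow> (LINT z|lborel. bump 1 z * u 0)"
  proof (rule integral_dominated_convergence[where w = "\<lambda>z. bump 1 z * B"])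
    show "integrable lborel (\<lambda>z. bump 1 z * B)"
      by (intro integrable_bump_mult) auto
    show "(\<lambda>z. bump 1 z * u 0) \<in> borel_measurable lborel" "(\<lambda>z. bump 1 z * u (h n *\<^sub>R z)) \<in> borel_measurable lborel" for n
      using borel_measurable_integrable[OF integrable_bump_mult[OF _ cu, of 1 "h n"]]
        borel_measurable_integrable[OF integrable_bump_mult[OF _ continuous_on_const, of 1 "u 0"]] by auto
    show "AE z in lborel. (\<lambda>n. bump 1 z * u (h n *\<^sub>R z)) \<longlonglongrightarrow> bump 1 z * u 0"
    proof (intro always_eventually allI)
      fix z :: "real^3"
      have "(\<lambda>n. h n *\<^sub>R z) \<longlonglongrightarrow> 0 *\<^sub>R z"
        by (intro tendsto_intros h0)
      moreover have "isCont u 0"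
        using assms by (simp add: continuous_on_eq_continuous_at)
      ultimately have "(\<lambda>n. u (h n *\<^sub>R z)) \<longlonglongrightarrow> u 0"
        using isCont_tendsto_compose by fastforce
      then show "(\<lambda>n. bump 1 z * u (h n *\<^sub>R z)) \<longlonglongrightarrow> bump 1 z * u 0"
        by (intro tendsto_intros)
    qed
    show "AE z in lborel. norm (bump 1 z * u (h n *\<^sub>R z)) \<le> bump 1 z * B" for n
    proof (intro always_eventually allI)
      fix z
      show "norm (bump 1 z * u (h n *\<^sub>R z)) \<le> bump 1 z * B"
      proof (cases "norm z \<le> 1")
        case True
        then have "norm (h n *\<^sub>R z) \<le> 1"
          using h[of n] by (simp add: mult_le_one)
        from B[OF this] show ?thesis
          by (simp add: abs_mult bump_bounds mult_left_mono)
      qed (simp add: bump_eq_0)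
    qed
  qed
  then show ?thesis
    using integral_bump_scale[OF h(1) assms] by (simp add: bump_mass_def h_def)
qed

text \<open>The condition on \<open>u\<close> is a form of decay at infinity that is shared by functions tending to zero and
  by functions in \<open>L^q\<close>. The weighted mean of \<open>u\<close> over the ball of radius \<open>r\<close> is at most \<open>\<delta> \<kappa>\<close> plus
  a multiple of \<open>r^(-3)\<close> times the integral of \<open>|g|\<close>.\<close>

lemma tendsto_integral_bump_at_top:
  assumes u: "continuous_on UNIV u"
    and decay: "\<And>\<delta>. 0 < \<delta> \<Longrightarrow> \<exists>g. integrable lborel g \<and> (\<forall>x. \<bar>u x\<bar> \<le> \<delta> + g x)"
  shows "((\<lambda>r. LINT z|lborel. bump r z * u z) \<longlongrightarrow> 0) at_top"
proof (rule tendstoI)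
  fix e :: real assume e: "0 < e"
  define \<delta> where "\<delta> = e / (2 * bump_mass)"
  have "0 < \<delta>" using e bump_mass_pos by (simp add: \<delta>_def)
  from decay[OF this] obtain g where g: "integrable lborel g" "\<And>x. \<bar>u x\<bar> \<le> \<delta> + g x"
    by auto
  define I where "I = (LINT z|lborel. \<bar>g z\<bar>)"
  have bound: "\<bar>LINT z|lborel. bump r z * u z\<bar> \<le> e / 2 + (15 / 2) * I / r^3" if r: "0 < r" for r
  proof -
    have int: "integrable lborel (\<lambda>z. bump r z * \<delta>)" "integrable lborel (\<lambda>z. (15 / 2) / r^3 * \<bar>g z\<bar>)"
      using g(1) r by (auto intro: integrable_bump)
    have "\<bar>LINT z|lborel. bump r z * u z\<bar> \<le> (LINT z|lborel. \<bar>bump r z * u z\<bar>)"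
      by (rule integral_abs_bound)
    also have "\<dots> \<le> (LINT z|lborel. bump r z * \<delta> + (15 / 2) / r^3 * \<bar>g z\<bar>)"
    proof (rule integral_mono)
      show "\<bar>bump r z * u z\<bar> \<le> bump r z * \<delta> + (15 / 2) / r^3 * \<bar>g z\<bar>" for z
      proof -
        have "\<bar>bump r z * u z\<bar> \<le> bump r z * (\<delta> + \<bar>g z\<bar>)"
          using bump_bounds(1)[OF r] g(2)[of z] by (auto simp: abs_mult intro!: mult_left_mono)
        also have "\<dots> \<le> bump r z * \<delta> + (15 / 2) / r^3 * \<bar>g z\<bar>"
          using mult_right_mono[OF bump_bounds(2)[OF r, of z], of "\<bar>g z\<bar>"] by (simp add: distrib_left)
        finally show ?thesis .
      qed
    qed (use integrable_bump_mult[OF r u] int in auto)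
    also have "\<dots> = (LINT z|lborel. bump r z * \<delta>) + (LINT z|lborel. (15 / 2) / r^3 * \<bar>g z\<bar>)"
      using int by (rule Bochner_Integration.integral_add)
    also have "\<dots> = e / 2 + (15 / 2) * I / r^3"
      using bump_mass_pos by (simp add: integral_bump[OF r] I_def \<delta>_def)
    finally show ?thesis .
  qed
  have "((\<lambda>r. (15 / 2) * I / r^3) \<longlongrightarrow> 0) at_top"
    by (intro tendsto_divide_0[OF tendsto_const] filterlim_at_top_imp_at_infinity filterlim_pow_at_top filterlim_ident) auto
  then have "eventually (\<lambda>r. (15 / 2) * I / r^3 < e / 2) at_top"
    by (rule order_tendstoD) (use e in auto)
  then show "eventually (\<lambda>r. dist (LINT z|lborel. bump r z * u z) 0 < e) at_top"
    using eventually_gt_at_top[of 0]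
  proof eventually_elim
    case (elim r)
    then show ?case using bound[of r] by simp
  qed
qed

text \<open>By the weak form, the sum of the bump integral \<open>N r\<close> and the field integral \<open>V r\<close> is the same
  for all \<open>r\<close>. Both tend to zero as \<open>r \<rightarrow> \<infinity>\<close>, so \<open>N r = - V r\<close>, and the limit \<open>r \<rightarrow> 0\<close> gives the formula.\<close>

lemma newtonian_representation_at_0:
  fixes u :: "real^3 \<Rightarrow> real" and F :: "real^3 \<Rightarrow> real^3"
  assumes u: "C_k 2 u" and F: "C_k 1 F" and eq: "\<And>x. laplacian u x = divergence F x"
    and int: "integrable lborel (\<lambda>z. norm (F z) / norm z^2)"
    and decay: "\<And>\<delta>. 0 < \<delta> \<Longrightarrow> \<exists>g. integrable lborel g \<and> (\<forall>x. \<bar>u x\<bar> \<le> \<delta> + g x)"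
  shows "integrable lborel (\<lambda>z. (z \<bullet> F z) / norm z^3)"
    and "(LINT z|lborel. (z \<bullet> F z) / norm z^3) = - (bump_mass * u 0)"
proof -
  have cu: "continuous_on UNIV u" and cF: "continuous_on UNIV F"
    using C_k_continuous[OF u] C_k_continuous[OF F] .
  define h where "h n = inverse (real (Suc n))" for n
  have h: "0 < h n" for n by (auto simp: h_def)
  have h0: "h \<longlonglongrightarrow> 0"
    unfolding h_def by (rule LIMSEQ_inverse_real_of_nat)
  define V where "V r = (LINT z|lborel. kern r z * (z \<bullet> F z))" for r
  define N where "N r = (LINT z|lborel. bump r z * u z)" for r
  let ?w = "\<lambda>z. (5 / 2) * (norm (F z) / norm z^2)"
  have w: "integrable lborel ?w"
    using int by (intro integrable_mult_right)
  have bm: "(\<lambda>z. kern r z * (z \<bullet> F z)) \<in> borel_measurable lborel" for r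
    unfolding measurable_lborel2
    by (intro borel_measurable_continuous_onI continuous_intros cF continuous_kern)
  have bm0: "(\<lambda>z. (z \<bullet> F z) / norm z^3) \<in> borel_measurable lborel"
    using borel_measurable_continuous_onI[OF cF] by measurable
  have est: "norm (kern r z * (z \<bullet> F z)) \<le> ?w z" if r: "0 < r" for r z
  proof (cases "z = 0")
    case False
    have "norm (kern r z * (z \<bullet> F z)) \<le> (5 / 2) / norm z^3 * (norm z * norm (F z))"
      unfolding real_norm_def abs_mult
      by (intro mult_mono) (use kern_bounds(1)[OF r, of z] kern_bounds(3)[OF r False] Cauchy_Schwarz_ineq2[of z "F z"] in auto)
    also have "\<dots> = ?w z"
      using False by (simp add: field_simps eval_nat_numeral)
    finally show ?thesis .
  qed simp
  have intV: "integrable lborel (\<lambda>z. kern r z * (z \<bullet> F z))" if "0 < r" for r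
    by (rule Bochner_Integration.integrable_bound[OF w bm]) (use est[OF that] in \<open>auto intro!: always_eventually order_trans[OF _ abs_ge_self]\<close>)
  have Green: "N \<epsilon> - N R = - (V \<epsilon> - V R)" if "0 < \<epsilon>" "\<epsilon> \<le> R" for \<epsilon> R
  proof -
    have "0 < R" using that by simp
    then show ?thesis
      using integral_bump_kern[OF u F eq that] that integrable_bump_mult[OF _ cu] intV
      by (simp add: N_def V_def left_diff_distrib)
  qed
  have top: "filterlim (\<lambda>n. real (Suc n)) at_top sequentially"
    using filterlim_real_sequentially filterlim_Suc filterlim_compose by blast
  have "(\<lambda>n. V (real (Suc n))) \<longlonglongrightarrow> (LINT z::real^3|lborel. 0)"
    unfolding V_def
  proof (rule integral_dominated_convergence[OF _ bm w])
    show "AE z in lborel. (\<lambda>n. kern (real (Suc n)) z * (z \<bullet> F z)) \<longlonglongrightarrow> 0"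
    proof (intro always_eventually allI tendsto_mult_left_zero)
      fix z
      have "((\<lambda>r::real. (5 / 2) / r^3) \<longlongrightarrow> (0::real)) at_top"
        by (intro tendsto_divide_0[OF tendsto_const] filterlim_at_top_imp_at_infinity filterlim_pow_at_top filterlim_ident) auto
      from filterlim_compose[OF this top]
      have "(\<lambda>n. (5 / 2) / real (Suc n)^3) \<longlonglongrightarrow> 0" .
      then show "(\<lambda>n. kern (real (Suc n)) z) \<longlonglongrightarrow> 0"
      proof (rule tendsto_sandwich[rotated 2, OF tendsto_const])
        show "eventually (\<lambda>n. 0 \<le> kern (real (Suc n)) z) sequentially"
          by (intro always_eventually allI kern_bounds) simp
        show "eventually (\<lambda>n. kern (real (Suc n)) z \<le> (5 / 2) / real (Suc n)^3) sequentially"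
          by (intro always_eventually allI kern_bounds) simp
      qed
    qed
    show "AE z in lborel. norm (kern (real (Suc n)) z * (z \<bullet> F z)) \<le> ?w z" for n
      by (intro always_eventually allI est) simp
  qed simp
  then have V_top: "(\<lambda>n. V (real (Suc n))) \<longlonglongrightarrow> 0" by simp
  have N_top: "(\<lambda>n. N (real (Suc n))) \<longlonglongrightarrow> 0"
    unfolding N_def using filterlim_compose[OF tendsto_integral_bump_at_top[OF cu decay] top] .
  have NV: "N \<epsilon> = - V \<epsilon>" if "0 < \<epsilon>" for \<epsilon>
  proof -
    have limN: "(\<lambda>n. N \<epsilon> - N (real (Suc n))) \<longlonglongrightarrow> N \<epsilon> - 0"
      and limV: "(\<lambda>n. - (V \<epsilon> - V (real (Suc n)))) \<longlonglongrightarrow> - (V \<epsilon> - 0)"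
      by (intro tendsto_intros N_top V_top)+
    have "eventually (\<lambda>n. \<epsilon> \<le> real (Suc n)) sequentially"
      using top by (simp only: filterlim_at_top)
    then have "eventually (\<lambda>n. N \<epsilon> - N (real (Suc n)) = - (V \<epsilon> - V (real (Suc n)))) sequentially"
      by (rule eventually_mono) (rule Green[OF that])
    from Lim_transform_eventually[OF limN this] limV have "N \<epsilon> - 0 = - (V \<epsilon> - 0)"
      by (rule LIMSEQ_unique)
    then show ?thesis by simp
  qed
  have lim0: "AE z in lborel. (\<lambda>n. kern (h n) z * (z \<bullet> F z)) \<longlonglongrightarrow> (z \<bullet> F z) / norm z^3"
  proof (intro always_eventually allI)
    fix z
    show "(\<lambda>n. kern (h n) z * (z \<bullet> F z)) \<longlonglongrightarrow> (z \<bullet> F z) / norm z^3"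
    proof (cases "z = 0")
      case False
      then have "eventually (\<lambda>n. h n < norm z) sequentially"
        using order_tendstoD(2)[OF h0] by simp
      then have "eventually (\<lambda>n. kern (h n) z * (z \<bullet> F z) = (z \<bullet> F z) / norm z^3) sequentially"
        by eventually_elim (simp add: kern_far h)
      then show ?thesis by (rule tendsto_eventually)
    qed simp
  qed
  have est0: "AE z in lborel. norm (kern (h n) z * (z \<bullet> F z)) \<le> ?w z" for n
    by (intro always_eventually allI est h)
  show "integrable lborel (\<lambda>z. (z \<bullet> F z) / norm z^3)"
    using integrable_dominated_convergence[OF bm0 bm w lim0 est0] .
  have "(\<lambda>n. V (h n)) \<longlonglongrightarrow> (LINT z|lborel. (z \<bullet> F z) / norm z^3)"
    unfolding V_def using integral_dominated_convergence[OF bm0 bm w lim0 est0] .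
  moreover have "(\<lambda>n. V (h n)) \<longlonglongrightarrow> - (bump_mass * u 0)"
    using tendsto_minus[OF tendsto_integral_bump_at_0[OF cu]] NV[OF h] by (simp add: N_def h_def)
  ultimately show "(LINT z|lborel. (z \<bullet> F z) / norm z^3) = - (bump_mass * u 0)"
    by (rule LIMSEQ_unique)
qed

section \<open>Integrability of the Newtonian kernel against functions in \<open>L^q\<close>\<close>

text \<open>A replacement for polar coordinates: \<open>|f|\<close> is dominated by a series of multiples of indicators of
  balls about the origin, which can be integrated term by term. It is used with radii \<open>2^k\<close> and
  \<open>2^(-k)\<close>.\<close>

lemma integrable_dyadic_bound:
  fixes f :: "'a::euclidean_space \<Rightarrow> real"
  assumes f: "f \<in> borel_measurable lborel" and c: "\<And>k. 0 \<le> c k" and \<rho>: "\<And>k. 0 \<le> \<rho> k"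
    and sum: "summable (\<lambda>k. c k * \<rho> k ^ DIM('a))"
    and bound: "\<And>z. z \<noteq> 0 \<Longrightarrow> f z \<noteq> 0 \<Longrightarrow> \<exists>k::nat. norm z < \<rho> k \<and> \<bar>f z\<bar> \<le> c k"
  shows "integrable lborel f"
proof (rule integrableI_bounded[OF f])
  let ?V = "unit_ball_vol (real DIM('a))"
  have le: "ennreal (norm (f z)) \<le> (\<Sum>k. ennreal (c k) * indicator (ball 0 (\<rho> k)) z)" if z: "z \<noteq> 0" for z
  proof (cases "f z = 0")
    case False
    from bound[OF z this] obtain k where k: "norm z < \<rho> k" "\<bar>f z\<bar> \<le> c k" by auto
    have "ennreal (norm (f z)) \<le> ennreal (c k) * indicator (ball 0 (\<rho> k)) z"
      using k by (simp add: ennreal_leI)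
    also have "\<dots> = (\<Sum>k\<in>{k}. ennreal (c k) * indicator (ball 0 (\<rho> k)) z)"
      by (simp only: sum.insert finite.emptyI empty_iff sum.empty add_0_right not_False_eq_True)
    also have "\<dots> \<le> (\<Sum>k. ennreal (c k) * indicator (ball 0 (\<rho> k)) z)"
      by (intro sum_le_suminf) auto
    finally show ?thesis .
  qed simp
  have "(\<integral>\<^sup>+ z. ennreal (norm (f z)) \<partial>lborel) \<le> (\<integral>\<^sup>+ z. (\<Sum>k. ennreal (c k) * indicator (ball 0 (\<rho> k)) (z::'a)) \<partial>lborel)"
  proof (rule nn_integral_mono_AE)
    show "AE z in lborel. ennreal (norm (f z)) \<le> (\<Sum>k. ennreal (c k) * indicator (ball 0 (\<rho> k)) (z::'a))"
      using AE_lborel_singleton[of "0::'a"] by (rule eventually_mono) (rule le)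
  qed
  also have "\<dots> = (\<Sum>k. \<integral>\<^sup>+ z. ennreal (c k) * indicator (ball 0 (\<rho> k)) (z::'a) \<partial>lborel)"
    by (intro nn_integral_suminf borel_measurable_times_ennreal borel_measurable_const borel_measurable_indicator) simp_all
  also have "\<dots> = (\<Sum>k. ennreal (?V * (c k * \<rho> k ^ DIM('a))))"
  proof (intro suminf_cong)
    fix k
    have "(\<integral>\<^sup>+ z. ennreal (c k) * indicator (ball 0 (\<rho> k)) (z::'a) \<partial>lborel)
        = ennreal (c k) * ennreal (?V * \<rho> k ^ DIM('a))"
      by (subst nn_integral_cmult_indicator) (simp_all add: emeasure_ball[OF \<rho>])
    also have "\<dots> = ennreal (c k * (?V * \<rho> k ^ DIM('a)))"
      by (rule ennreal_mult[symmetric]) (use c \<rho> in auto)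
    finally show "(\<integral>\<^sup>+ z. ennreal (c k) * indicator (ball 0 (\<rho> k)) (z::'a) \<partial>lborel)
        = ennreal (?V * (c k * \<rho> k ^ DIM('a)))"
      by (simp only: mult.left_commute)
  qed
  also have "\<dots> < \<infinity>"
  proof -
    have "(\<Sum>k. ennreal (?V * (c k * \<rho> k ^ DIM('a)))) \<noteq> top"
      by (rule ennreal_suminf_neq_top[OF summable_mult[OF sum]]) (use c \<rho> in auto)
    then show ?thesis by (simp add: top.not_eq_extremum)
  qed
  finally show "(\<integral>\<^sup>+ z. ennreal (norm (f z)) \<partial>lborel) < \<infinity>" .
qed

lemma integrable_inverse_square_near:
  "integrable lborel (\<lambda>z::real^3. indicator (ball 0 1) z / norm z^2)"
proof (rule integrable_dyadic_bound[where c = "\<lambda>k. 4 * 4^k" and \<rho> = "\<lambda>k. (1/2)^k"])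
  have "4 * 4^k * ((1/2)^k)^DIM(real^3) = 4 * (1/2::real)^k" for k
  proof -
    have "(4::real)^k * ((1/2)^k)^3 = (4 * (1/2)^3)^k"
      by (simp add: power_mult_distrib power_commutes flip: power_mult) (simp add: mult.commute)
    then show ?thesis by (simp add: power3_eq_cube)
  qed
  then show "summable (\<lambda>k. 4 * 4^k * ((1/2::real)^k)^DIM(real^3))"
    by (simp only:) (intro summable_mult summable_geometric; simp)
  fix z :: "real^3" assume z: "z \<noteq> 0" "indicator (ball 0 1) z / (norm z)\<^sup>2 \<noteq> (0::real)"
  then have z1: "norm z < 1" by (auto simp: indicator_def split: if_splits)
  obtain n where "(1/2)^n < norm z"
    using real_arch_pow_inv[of "norm z" "1/2"] z by auto
  from ex_least_nat_le[of "\<lambda>n. (1/2)^n \<le> norm z", OF less_imp_le[OF this]]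
  obtain m where m: "\<forall>i<m. \<not> (1/2)^i \<le> norm z" "(1/2)^m \<le> norm z" by auto
  have "m \<noteq> 0" using m(2) z1 by (cases m) auto
  then obtain k where k: "m = Suc k" by (cases m) auto
  have "((1/2)^m)^2 \<le> norm z^2"
    using m(2) by (intro power_mono) auto
  moreover have "((1/2)^m)^2 = 1 / (4 * 4^k :: real)"
    by (simp add: k power_divide power_mult_distrib) (simp add: power2_eq_square flip: power_mult_distrib)
  ultimately have "1 / norm z^2 \<le> 4 * 4^k"
    using z by (simp add: field_simps)
  moreover have "norm z < (1/2)^k"
    using m(1) k by auto
  ultimately show "\<exists>k. norm z < (1/2)^k \<and> \<bar>indicator (ball 0 1) z / (norm z)\<^sup>2\<bar> \<le> 4 * 4^k"
    using z1 by auto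
next
  show "(\<lambda>z::real^3. indicator (ball 0 1) z / norm z^2) \<in> borel_measurable lborel"
    unfolding measurable_lborel2
    by (intro borel_measurable_divide borel_measurable_indicator borel_measurable_power borel_measurable_norm) simp_all
qed auto

lemma integrable_powr_far:
  assumes a: "3 < a"
  shows "integrable lborel (\<lambda>z::real^3. indicator (- ball 0 1) z * norm z powr (- a))"
proof (rule integrable_dyadic_bound[where c = "\<lambda>k. (2 powr (-a))^k" and \<rho> = "\<lambda>k. 2 * 2^k"])
  have "(2 powr (-a))^k * (2 * 2^k)^DIM(real^3) = 8 * (8 * 2 powr (-a))^k" for k
  proof -
    have "((2::real)^k)^3 = 8^k"
      by (simp add: power3_eq_cube flip: power_mult_distrib)
    then show ?thesis by (simp add: power_mult_distrib)
  qed
  moreover have "8 * 2 powr (-a) < 1"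
  proof -
    have "8 * 2 powr (-a) = 2 powr (3 - a)"
      by (simp add: powr_diff powr_minus_divide powr_numeral)
    also have "\<dots> < 1" using a by (simp add: powr_less_one)
    finally show ?thesis .
  qed
  ultimately show "summable (\<lambda>k. (2 powr (-a))^k * (2 * 2^k)^DIM(real^3))"
    by (simp only:) (intro summable_mult summable_geometric; simp)
  fix z :: "real^3" assume z: "z \<noteq> 0" "indicator (- ball 0 1) z * norm z powr (- a) \<noteq> 0"
  then have z1: "1 \<le> norm z" by (auto simp: indicator_def split: if_splits)
  obtain n where "norm z < 2^n"
    using real_arch_pow[of 2 "norm z"] by auto
  from ex_least_nat_le[of "\<lambda>n. norm z < 2^n", OF this]
  obtain m where m: "\<forall>i<m. \<not> norm z < 2^i" "norm z < 2^m" by auto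
  have "m \<noteq> 0" using m(2) z1 by (cases m) auto
  then obtain k where k: "m = Suc k" by (cases m) auto
  have "2^k \<le> norm z" using m(1) k by auto
  then have "norm z powr (- a) \<le> (2^k) powr (-a)"
    using a by (intro powr_mono2') auto
  also have "\<dots> = (2 powr (-a))^k"
    by (simp add: powr_powr mult.commute flip: powr_realpow)
  finally show "\<exists>k. norm z < 2 * 2^k \<and> \<bar>indicator (- ball 0 1) z * norm z powr (- a)\<bar> \<le> (2 powr (-a))^k"
    using m(2) z1 k by auto
next
  show "(\<lambda>z::real^3. indicator (- ball 0 1) z * norm z powr (- a)) \<in> borel_measurable lborel"
    unfolding measurable_lborel2
    by (intro borel_measurable_times borel_measurable_indicator powr_real_measurable borel_measurable_norm) simp_all
qed auto

text \<open>Near the origin \<open>F\<close> is bounded and \<open>1 / |z|^2\<close> is integrable. Far away, Young's inequality leaves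
  \<open>|z|^(- 2 q')\<close> with the conjugate exponent \<open>q'\<close>, which is integrable at infinity because \<open>q < 3\<close>
  means \<open>2 q' > 3\<close>.\<close>

lemma integrable_div_norm_square:
  fixes F :: "real^3 \<Rightarrow> real^3"
  assumes q: "1 < q" "q < 3" and F: "continuous_on UNIV F"
    and Lq: "integrable lborel (\<lambda>z. norm (F z) powr q)"
  shows "integrable lborel (\<lambda>z. norm (F z) / norm z^2)"
proof -
  define q' where "q' = q / (q - 1)"
  have q': "1 < q'" "1 / q' + 1 / q = 1" "3 < 2 * q'"
    using q by (simp_all add: q'_def less_divide_eq diff_divide_distrib)
  have "bounded (F ` cball 0 1)"
    by (intro compact_imp_bounded compact_continuous_image continuous_on_subset[OF F]) auto
  then obtain B where B: "\<And>z. norm z \<le> 1 \<Longrightarrow> norm (F z) \<le> B"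
    unfolding bounded_iff by (metis image_eqI mem_cball_0)
  let ?w = "\<lambda>z::real^3. B * (indicator (ball 0 1) z / norm z^2) + indicator (- ball 0 1) z * norm z powr (- (2 * q'))
    + norm (F z) powr q"
  have int: "integrable lborel ?w"
    by (intro Bochner_Integration.integrable_add integrable_mult_right integrable_inverse_square_near
        integrable_powr_far q' Lq)
  have bm: "(\<lambda>z. norm (F z) / norm z^2) \<in> borel_measurable lborel"
  proof -
    have "F \<in> borel_measurable borel"
      using F by (rule borel_measurable_continuous_onI)
    then show ?thesis by measurable
  qed
  have le: "norm (F z) / norm z^2 \<le> ?w z" for z
  proof (cases "norm z < 1")
    case True
    then have "norm (F z) / norm z^2 \<le> B / norm z^2"
      using B[of z] by (intro divide_right_mono) auto
    then show ?thesis using True by (simp add: add_increasing2)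
  next
    case False
    then have z: "0 < norm z" by (cases "z = 0") auto
    have div_le: "x / p \<le> x" if "1 < p" "0 \<le> x" for x p :: real
      using that by (simp add: divide_le_eq mult_le_cancel_left1)
    have "norm (F z) / norm z^2 = norm z powr (-2) * norm (F z)"
      using z by (simp add: powr_minus_divide powr_numeral)
    also have "\<dots> \<le> (norm z powr (-2)) powr q' / q' + norm (F z) powr q / q"
      using q q' by (intro Youngs_inequality) auto
    also have "\<dots> \<le> (norm z powr (-2)) powr q' + norm (F z) powr q"
      using q q' by (intro add_mono div_le) auto
    also have "\<dots> = norm z powr (- (2 * q')) + norm (F z) powr q"
      by (simp add: powr_powr)
    finally show ?thesis using False by simp
  qed
  show ?thesis
  proof (rule Bochner_Integration.integrable_bound[OF int bm], intro always_eventually allI)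
    fix z
    have "norm (norm (F z) / norm z^2) = norm (F z) / norm z^2" by simp
    also have "\<dots> \<le> norm (?w z)"
      unfolding real_norm_def by (rule order_trans[OF le abs_ge_self])
    finally show "norm (norm (F z) / norm z^2) \<le> norm (?w z)" .
  qed
qed

section \<open>The Newtonian representation at an arbitrary point\<close>

lemma partial_shift:
  assumes "f differentiable (at (c + y))"
  shows "partial i (\<lambda>y. f (c + y)) y = partial i f (c + y)"
    and "(\<lambda>y. f (c + y)) differentiable (at y)"
proof -
  have "((\<lambda>y. f (c + y)) has_derivative frechet_derivative f (at (c + y))) (at y)"
  proof (rule has_derivative_compose[of "(+) c"])
    show "((+) c has_derivative (\<lambda>h. h)) (at y)"
      by (auto intro!: derivative_eq_intros)
    show "(f has_derivative frechet_derivative f (at (c + y))) (at (c + y))"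
      using assms frechet_derivative_works by blast
  qed
  then show "partial i (\<lambda>y. f (c + y)) y = partial i f (c + y)"
    "(\<lambda>y. f (c + y)) differentiable (at y)"
    using partial_eqI unfolding partial_def differentiable_def by blast+
qed

lemma C_k_shift: "C_k k f \<Longrightarrow> C_k k (\<lambda>y. f (c + y))"
proof (induction k arbitrary: f)
  case 0
  then show ?case
    by (auto intro!: continuous_on_compose2[of UNIV f] continuous_intros)
next
  case (Suc k)
  have "partial i (\<lambda>y. f (c + y)) = (\<lambda>y. partial i f (c + y))" for i
    by (intro ext partial_shift C_k_differentiable[OF Suc.prems])
  moreover have "(\<lambda>y. f (c + y)) differentiable (at y)" for y
    by (intro partial_shift C_k_differentiable[OF Suc.prems])
  ultimately show ?case
    using Suc by (auto simp: differentiable_on_def)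
qed

lemma C_k_1_differentiable: "C_k 1 f \<Longrightarrow> f differentiable (at x)"
  using C_k_differentiable[of 0] by (simp del: C_k.simps)

lemma C_k_2_differentiable:
  assumes "C_k 2 f"
  shows "f differentiable (at x)" "partial i f differentiable (at x)"
  by (rule C_k_1_differentiable[OF C_k_2D(1)[OF assms]], rule C_k_1_differentiable[OF C_k_2D(2)[OF assms]])

lemma laplacian_shift:
  assumes "C_k 2 f"
  shows "laplacian (\<lambda>y. f (c + y)) y = laplacian f (c + y)"
proof -
  have "partial i (\<lambda>y. f (c + y)) = (\<lambda>y. partial i f (c + y))" for i
    by (intro ext partial_shift C_k_2_differentiable[OF assms])
  then show ?thesis
    by (simp add: laplacian_def partial_shift(1)[OF C_k_2_differentiable(2)[OF assms]])
qed

lemma divergence_shift: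
  assumes "C_k 1 F"
  shows "divergence (\<lambda>y. F (c + y)) y = divergence F (c + y)"
  unfolding divergence_def
  by (intro sum.cong refl partial_shift(1)[of "\<lambda>y. F y $ i" for i]
      C_k_1_differentiable C_k_bounded_linear[OF bounded_linear_vec_nth assms])

lemma newtonian_representation:
  fixes u :: "real^3 \<Rightarrow> real" and F :: "real^3 \<Rightarrow> real^3"
  assumes u: "C_k 2 u" and F: "C_k 1 F" and eq: "\<And>x. laplacian u x = divergence F x"
    and q: "1 < q" "q < 3" and Lq: "integrable lborel (\<lambda>z. norm (F z) powr q)"
    and decay: "\<And>\<delta>. 0 < \<delta> \<Longrightarrow> \<exists>g. integrable lborel g \<and> (\<forall>x. \<bar>u x\<bar> \<le> \<delta> + g x)"
  shows "integrable lborel (\<lambda>y. ((y - x) \<bullet> F y) / norm (y - x)^3)"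
    and "(LINT y|lborel. ((y - x) \<bullet> F y) / norm (y - x)^3) = - (bump_mass * u x)"
proof -
  let ?k = "\<lambda>y. ((y - x) \<bullet> F y) / norm (y - x)^3"
  have F': "C_k 1 (\<lambda>y. F (x + y))"
    by (rule C_k_shift[OF F])
  have "\<exists>g. integrable lborel g \<and> (\<forall>y. \<bar>u (x + y)\<bar> \<le> \<delta> + g y)" if \<delta>: "0 < \<delta>" for \<delta>
  proof -
    from decay[OF \<delta>] obtain g where "integrable lborel g" "\<forall>x. \<bar>u x\<bar> \<le> \<delta> + g x" by auto
    then show ?thesis
      by (intro exI[of _ "\<lambda>y. g (x + y)"]) (auto intro: integrable_lborel_translate)
  qed
  moreover have "integrable lborel (\<lambda>z. norm (F (x + z)) / norm z^2)"
    using integrable_lborel_translate[OF Lq, of x]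
    by (intro integrable_div_norm_square[OF q C_k_continuous[OF F']])
  moreover have "laplacian (\<lambda>y. u (x + y)) y = divergence (\<lambda>y. F (x + y)) y" for y
    by (simp only: laplacian_shift[OF u] divergence_shift[OF F] eq)
  ultimately have 0: "integrable lborel (\<lambda>z. (z \<bullet> F (x + z)) / norm z^3)"
      "(LINT z|lborel. (z \<bullet> F (x + z)) / norm z^3) = - (bump_mass * u (x + 0))"
    using newtonian_representation_at_0[OF C_k_shift[OF u] F'] by blast+
  have "integrable lborel (\<lambda>y. ((- x + y) \<bullet> F (x + (- x + y))) / norm (- x + y)^3)"
    by (rule integrable_lborel_translate[OF 0(1)])
  then show int: "integrable lborel ?k" by simp
  have "?k \<in> borel_measurable borel"
    using borel_measurable_integrable[OF int] by simp
  from integral_lborel_translate[OF this, of x] 0(2)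
  show "(LINT y|lborel. ?k y) = - (bump_mass * u x)" by simp
qed

section \<open>Identities for the curl\<close>

text \<open>Vector forms of curl and divergence, in which derivatives are taken of whole vector fields so that
  the product rules for bilinear maps apply.\<close>

lemma curl_eq:
  assumes "v differentiable (at x)"
  shows "curl v x = (\<Sum>j\<in>UNIV. axis j 1 \<times> partial j v x)"
  by (simp add: curl_def partial_vec_nth[OF assms] sum_3 vec_eq_iff forall_3 cross3_def axis_def)

lemma divergence_eq:
  assumes "v differentiable (at x)"
  shows "divergence v x = (\<Sum>i\<in>UNIV. partial i v x $ i)"
  by (simp add: divergence_def partial_vec_nth[OF assms])

lemma bounded_bilinear_cross: "bounded_bilinear cross3"
  using bilinear_cross bilinear_conv_bounded_bilinear by blast

lemma C_k_cross: "C_k k f \<Longrightarrow> C_k k g \<Longrightarrow> C_k k (\<lambda>y. f y \<times> g y)"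
  by (rule C_k_bounded_bilinear[OF bounded_bilinear_cross])

lemma partial_cross:
  assumes "f differentiable (at x)" "g differentiable (at x)"
  shows "partial i (\<lambda>y. f y \<times> g y) x = f x \<times> partial i g x + partial i f x \<times> g x"
  by (rule partial_bounded_bilinear[OF bounded_bilinear_cross assms])

lemma partial_cross_const:
  assumes "f differentiable (at x)"
  shows "partial i (\<lambda>y. a \<times> f y) x = a \<times> partial i f x"
  by (rule partial_bounded_linear[OF bounded_bilinear.bounded_linear_right[OF bounded_bilinear_cross] assms])

lemma C_k_curl:
  assumes v: "C_k (Suc k) v"
  shows "C_k k (curl v)"
proof -
  have "curl v = (\<lambda>x. \<Sum>j\<in>UNIV. axis j 1 \<times> partial j v x)"
    by (intro ext curl_eq C_k_differentiable[OF v])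
  then show ?thesis
    by (simp only:) (intro C_k_sum C_k_cross C_k_const C_k_partial[OF v])
qed

lemma partial_curl:
  assumes v: "C_k 2 v"
  shows "partial i (curl v) x = (\<Sum>j\<in>UNIV. axis j 1 \<times> partial i (partial j v) x)"
proof -
  note d = C_k_2_differentiable[OF v]
  have c: "curl v = (\<lambda>x. \<Sum>j\<in>UNIV. axis j 1 \<times> partial j v x)"
    by (intro ext curl_eq d)
  have "partial i (curl v) x = (\<Sum>j\<in>UNIV. partial i (\<lambda>y. axis j 1 \<times> partial j v y) x)"
    unfolding c
    by (intro partial_sum C_k_1_differentiable C_k_cross C_k_const C_k_2D[OF v])
  then show ?thesis
    by (simp add: partial_cross_const[OF d(2)])
qed

lemma divergence_cross_const:
  assumes "C_k 1 w"
  shows "divergence (\<lambda>y. a \<times> w y) x = - (a \<bullet> curl w x)"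
proof -
  note d = C_k_1_differentiable[OF assms]
  have "divergence (\<lambda>y. a \<times> w y) x = (\<Sum>i\<in>UNIV. (a \<times> partial i w x) $ i)"
    by (simp add: divergence_eq C_k_1_differentiable C_k_cross C_k_const assms partial_cross_const[OF d] del: C_k.simps One_nat_def)
  then show ?thesis
    by (simp add: curl_def partial_vec_nth[OF d] sum_3 inner_vec_def cross3_def algebra_simps)
qed

lemma laplacian_inner_const:
  assumes "C_k 2 v"
  shows "laplacian (\<lambda>y. a \<bullet> v y) x = a \<bullet> laplacian v x"
proof -
  note d = C_k_2_differentiable[OF assms]
  have "partial i (\<lambda>y. a \<bullet> v y) = (\<lambda>y. a \<bullet> partial i v y)" for i
    by (intro ext partial_bounded_linear[OF bounded_linear_inner_right] d)
  then show ?thesis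
    by (simp add: laplacian_def inner_sum_right partial_bounded_linear[OF bounded_linear_inner_right d(2)])
qed

lemma curl_curl_div_free:
  fixes v :: "real^3 \<Rightarrow> real^3"
  assumes v: "C_k 2 v" and div: "\<And>x. divergence v x = 0"
  shows "curl (curl v) x = - laplacian v x"
proof -
  note d = C_k_2_differentiable[OF v]
  define T where "T i j = partial i (partial j v) x" for i j
  have sym: "T i j = T j i" for i j
    unfolding T_def by (rule partial_commute[OF v])
  have c: "partial i (curl v) x = (\<Sum>j\<in>UNIV. axis j 1 \<times> T i j)" for i
    unfolding T_def by (rule partial_curl[OF v])
  have "T i 1 $ 1 + T i 2 $ 2 + T i 3 $ 3 = 0" for i
  proof -
    have "partial i (\<lambda>y. \<Sum>j\<in>UNIV. partial j v y $ j) x = (\<Sum>j\<in>UNIV. partial i (\<lambda>y. partial j v y $ j) x)"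
      by (intro partial_sum C_k_1_differentiable C_k_bounded_linear[OF bounded_linear_vec_nth] C_k_2D[OF v])
    moreover have "(\<lambda>y. \<Sum>j\<in>UNIV. partial j v y $ j) = (\<lambda>_. 0)"
      using div by (simp add: divergence_eq[OF d(1)])
    ultimately show ?thesis
      by (simp add: partial_vec_nth[OF d(2)] T_def sum_3 partial_def[of i "\<lambda>_. 0"])
  qed
  then have tr: "T i 1 $ 1 = - T i 2 $ 2 - T i 3 $ 3" for i
    by (smt (verit))
  have "curl (curl v) x = (\<Sum>i\<in>UNIV. axis i 1 \<times> partial i (curl v) x)"
    using C_k_curl[of 1 v] v by (intro curl_eq C_k_1_differentiable) (simp only: Suc_1)
  also have "\<dots> = - (\<Sum>i\<in>UNIV. T i i)"
    using tr[of 1] tr[of 2] tr[of 3] sym[of 1 2] sym[of 1 3] sym[of 2 3]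
    by (simp add: c sum_3 vec_eq_iff forall_3 cross3_def axis_def)
  finally show ?thesis
    by (simp add: laplacian_def T_def)
qed

lemma laplacian_curl:
  fixes v :: "real^3 \<Rightarrow> real^3"
  assumes v: "C_k 3 v"
  shows "laplacian (curl v) x = curl (laplacian v) x"
proof -
  have v2: "C_k 2 v" and pv: "C_k 2 (partial i v)" for i
    using v C_k_SucD[of 2 v] by (simp_all add: eval_nat_numeral)
  have ppv: "C_k 1 (partial i (partial j v))" for i j
    by (rule C_k_2D[OF pv])
  have p: "partial i (curl v) = (\<lambda>x. \<Sum>j\<in>UNIV. axis j 1 \<times> partial i (partial j v) x)" for i
    by (intro ext partial_curl v2)
  have pp: "partial i (partial i (curl v)) x = (\<Sum>j\<in>UNIV. axis j 1 \<times> partial i (partial i (partial j v)) x)" for i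
    unfolding p
    by (subst partial_sum) (intro C_k_1_differentiable C_k_cross C_k_const ppv,
        simp add: partial_cross_const[OF C_k_1_differentiable[OF ppv]])
  define L where "L i j = partial j (partial i (partial i v)) x" for i j
  have comm: "partial i (partial i (partial j v)) x = L i j" for i j
  proof -
    have "partial i (partial j v) = partial j (partial i v)"
      by (intro ext partial_commute v2)
    then show ?thesis by (simp only: L_def partial_commute[OF pv, of i j])
  qed
  have lap: "laplacian v = (\<lambda>x. \<Sum>i\<in>UNIV. partial i (partial i v) x)"
    by (simp add: laplacian_def fun_eq_iff)
  have C1: "C_k 1 (laplacian v)"
    unfolding lap by (intro C_k_sum ppv)
  have pl: "partial j (laplacian v) x = (\<Sum>i\<in>UNIV. L i j)" for j
    unfolding lap L_def by (intro partial_sum C_k_1_differentiable ppv)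
  show ?thesis
    unfolding curl_eq[OF C_k_1_differentiable[OF C1]] pl
    by (simp add: laplacian_def[of "curl v"] pp comm)
      (simp add: sum_3 cross_add_right)
qed

lemma curl_grad:
  assumes "C_k 2 p"
  shows "C_k 1 (grad p)" "curl (grad p) x = 0"
proof -
  have g: "(\<lambda>y. grad p y $ i) = partial i p" for i
    by (simp add: grad_def fun_eq_iff)
  have "grad p = (\<lambda>x. \<Sum>i\<in>UNIV. partial i p x *\<^sub>R axis i 1)"
    by (simp add: grad_def fun_eq_iff vec_eq_iff sum_3 axis_def forall_3)
  then show "C_k 1 (grad p)"
    by (simp only:) (intro C_k_sum C_k_bounded_bilinear[OF bounded_bilinear_scaleR] C_k_const C_k_2D[OF assms])
  show "curl (grad p) x = 0"
    by (simp add: curl_def g partial_commute_real[OF assms, of 2 3] partial_commute_real[OF assms, of 3 1]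
        partial_commute_real[OF assms, of 1 2] vec_eq_iff forall_3)
qed

text \<open>Both sides agree because \<open>(v \<bullet> \<nabla>) v\<close> and \<open>- v \<times> curl v\<close> differ by the gradient of \<open>|v|^2 / 2\<close>. The
  proof compares the components directly, using only that second derivatives commute.\<close>

lemma curl_convective:
  fixes v :: "real^3 \<Rightarrow> real^3"
  assumes v: "C_k 2 v"
  shows "C_k 1 (convective v v)"
    and "curl (convective v v) x = - curl (\<lambda>y. v y \<times> curl v y) x"
proof -
  note d = C_k_2_differentiable[OF v]
  have conv: "convective v v = (\<lambda>x. \<Sum>i\<in>UNIV. (v x $ i) *\<^sub>R partial i v x)"
    by (simp add: convective_def fun_eq_iff)
  have vi: "C_k 1 (\<lambda>x. (v x $ i) *\<^sub>R partial i v x)" for i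
    by (intro C_k_bounded_bilinear[OF bounded_bilinear_scaleR] C_k_bounded_linear[OF bounded_linear_vec_nth]
        C_k_2D[OF v])
  show C1: "C_k 1 (convective v v)"
    unfolding conv by (intro C_k_sum vi)
  have C1c: "C_k 1 (curl v)"
    using C_k_curl[of 1 v] v by (simp only: Suc_1)
  define T where "T i j = partial i (partial j v) x" for i j
  have sym: "T i j = T j i" for i j
    unfolding T_def by (rule partial_commute[OF v])
  define D where "D i = partial i v x" for i
  have pc: "partial j (convective v v) x = (\<Sum>i\<in>UNIV. (v x $ i) *\<^sub>R T j i + (D j $ i) *\<^sub>R D i)" for j
  proof -
    have "partial j (convective v v) x = (\<Sum>i\<in>UNIV. partial j (\<lambda>x. (v x $ i) *\<^sub>R partial i v x) x)"
      unfolding conv by (intro partial_sum C_k_1_differentiable vi)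
    moreover have "partial j (\<lambda>x. (v x $ i) *\<^sub>R partial i v x) x = (v x $ i) *\<^sub>R T j i + (D j $ i) *\<^sub>R D i" for i
    proof -
      have "(\<lambda>x. v x $ i) differentiable (at x)"
        using C_k_bounded_linear[OF bounded_linear_vec_nth C_k_2D(1)[OF v]] by (rule C_k_1_differentiable)
      from partial_bounded_bilinear[OF bounded_bilinear_scaleR this d(2)]
      show ?thesis by (simp add: partial_vec_nth[OF d(1)] T_def D_def)
    qed
    ultimately show ?thesis by simp
  qed
  have pw: "partial j (\<lambda>y. v y \<times> curl v y) x
      = v x \<times> (\<Sum>i\<in>UNIV. axis i 1 \<times> T j i) + D j \<times> (\<Sum>i\<in>UNIV. axis i 1 \<times> D i)" for j
    unfolding partial_cross[OF d(1) C_k_1_differentiable[OF C1c]]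
    by (simp add: partial_curl[OF v] curl_eq[OF d(1)] T_def D_def)
  have "curl (\<lambda>y. v y \<times> curl v y) x = (\<Sum>j\<in>UNIV. axis j 1 \<times> partial j (\<lambda>y. v y \<times> curl v y) x)"
    by (intro curl_eq C_k_1_differentiable C_k_cross C1c C_k_2D[OF v])
  moreover have "curl (convective v v) x = (\<Sum>j\<in>UNIV. axis j 1 \<times> partial j (convective v v) x)"
    by (intro curl_eq C_k_1_differentiable C1)
  ultimately show "curl (convective v v) x = - curl (\<lambda>y. v y \<times> curl v y) x"
    using sym[of 1 2] sym[of 1 3] sym[of 2 3]
    by (simp only: pc pw) (simp add: sum_3 vec_eq_iff forall_3 cross3_def axis_def algebra_simps)
qed

section \<open>Decay and integrability of the velocity and the vorticity\<close>

lemma norm_cross_le: "norm (x \<times> y) \<le> norm x * norm y"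
proof -
  have "(norm (x \<times> y))^2 \<le> (norm x * norm y)^2"
    using norm_cross_dot[of x y] zero_le_power2[of "x \<bullet> y"] by linarith
  then show ?thesis
    by (rule power2_le_imp_le) simp
qed

lemma le_eps_plus_powr:
  fixes t :: real
  assumes "0 < \<delta>" "0 \<le> t" "1 < q"
  shows "t \<le> \<delta> + \<delta> powr (1 - q) * t powr q"
proof (cases "t \<le> \<delta>")
  case False
  then have "t = t powr (1 - q) * t powr q"
    using assms by (simp flip: powr_add)
  also have "\<dots> \<le> \<delta> powr (1 - q) * t powr q"
    using False assms by (intro mult_right_mono powr_mono2') auto
  finally show ?thesis using assms by linarith
qed (use assms in \<open>simp add: add_increasing2\<close>)

lemma decay_imp_small_plus_integrable:
  fixes v :: "'a::euclidean_space \<Rightarrow> 'b::euclidean_space"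
  assumes v: "continuous_on UNIV v" and lim: "((\<lambda>x. norm (v x)) \<longlongrightarrow> 0) at_infinity" and \<delta>: "0 < \<delta>"
  shows "\<exists>g. integrable lborel g \<and> (\<forall>x. norm (v x) \<le> \<delta> + g x)"
proof -
  from order_tendstoD(2)[OF lim \<delta>] obtain b where b: "\<And>x. b \<le> norm x \<Longrightarrow> norm (v x) < \<delta>"
    by (auto simp: eventually_at_infinity)
  let ?g = "\<lambda>x. indicator (cball 0 b) x *\<^sub>R norm (v x)"
  have "integrable lborel ?g"
    by (intro borel_integrable_compact continuous_on_norm continuous_on_subset[OF v]) auto
  moreover have "norm (v x) \<le> \<delta> + ?g x" for x
    using b[of x] \<delta> by (cases "norm x \<le> b") auto
  ultimately show ?thesis by auto
qed

lemma Lp_imp_small_plus_integrable: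
  assumes "integrable lborel (\<lambda>x. norm (f x) powr q)" "1 < q" "0 < \<delta>"
  shows "\<exists>g. integrable lborel g \<and> (\<forall>x. norm (f x) \<le> \<delta> + g x)"
  using assms by (intro exI[of _ "\<lambda>x. \<delta> powr (1 - q) * norm (f x) powr q"]) (auto intro: le_eps_plus_powr)

lemma small_plus_integrable_inner:
  fixes v :: "'a::euclidean_space \<Rightarrow> 'b::euclidean_space"
  assumes v: "\<And>\<delta>. 0 < \<delta> \<Longrightarrow> \<exists>g. integrable lborel g \<and> (\<forall>x. norm (v x) \<le> \<delta> + g x)" and \<delta>: "0 < \<delta>"
  shows "\<exists>g. integrable lborel g \<and> (\<forall>x. \<bar>a \<bullet> v x\<bar> \<le> \<delta> + g x)"
proof -
  define c where "c = norm a + 1"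
  have c: "0 < c" by (simp add: c_def add_nonneg_pos)
  from v[of "\<delta> / c"] obtain g where g: "integrable lborel g" "\<And>x. norm (v x) \<le> \<delta> / c + g x"
    using c \<delta> by auto
  have "\<bar>a \<bullet> v x\<bar> \<le> \<delta> + c * g x" for x
  proof -
    have "\<bar>a \<bullet> v x\<bar> \<le> norm a * norm (v x)"
      by (rule Cauchy_Schwarz_ineq2)
    also have "\<dots> \<le> c * (\<delta> / c + g x)"
      using g(2)[of x] c by (intro mult_mono) (auto simp: c_def)
    also have "\<dots> = \<delta> + c * g x"
      using c by (simp add: distrib_left)
    finally show ?thesis .
  qed
  moreover have "integrable lborel (\<lambda>x. c * g x)"
    using g(1) by (rule integrable_mult_right)
  ultimately show ?thesis by blast
qed

lemma integrable_powr_bound: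
  assumes f: "integrable lborel (\<lambda>z. norm (f z) powr q)" and F: "continuous_on UNIV F"
    and le: "\<And>z. norm (F z) \<le> C * norm (f z)" and C: "0 \<le> C" and q: "0 \<le> q"
  shows "integrable lborel (\<lambda>z. norm (F z) powr q)"
proof (rule Bochner_Integration.integrable_bound)
  show "integrable lborel (\<lambda>z. C powr q * norm (f z) powr q)"
    using f by (rule integrable_mult_right)
  have "F \<in> borel_measurable borel"
    using F by (rule borel_measurable_continuous_onI)
  then show "(\<lambda>z. norm (F z) powr q) \<in> borel_measurable lborel"
    by measurable
  have "norm (F z) powr q \<le> C powr q * norm (f z) powr q" for z
    using powr_mono2[OF q norm_ge_zero le] C by (simp add: powr_mult)
  then show "AE z in lborel. norm (norm (F z) powr q) \<le> norm (C powr q * norm (f z) powr q)"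
    by simp
qed

section \<open>The kernel \<open>\<Phi>\<close> and the dichotomy\<close>

lemma nn_integral_neg_part:
  fixes f :: "'a \<Rightarrow> real"
  assumes f: "integrable M f" and le: "(LINT x|M. f x) \<le> 0"
  shows "(\<integral>\<^sup>+ x. ennreal (max 0 (- f x)) \<partial>M) = (\<integral>\<^sup>+ x. ennreal (max 0 (f x)) \<partial>M) + ennreal (- (LINT x|M. f x))"
proof -
  have int: "integrable M (\<lambda>x. max 0 (f x))" "integrable M (\<lambda>x. max 0 (- f x))"
    using f by auto
  have "(LINT x|M. f x) = (LINT x|M. max 0 (f x) - max 0 (- f x))"
    by (intro Bochner_Integration.integral_cong) auto
  also have "\<dots> = (LINT x|M. max 0 (f x)) - (LINT x|M. max 0 (- f x))"
    by (rule Bochner_Integration.integral_diff[OF int])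
  finally have "(LINT x|M. max 0 (- f x)) = (LINT x|M. max 0 (f x)) + (- (LINT x|M. f x))"
    by simp
  moreover have "0 \<le> (LINT x|M. max 0 (f x))"
    by (intro Bochner_Integration.integral_nonneg) simp
  ultimately show ?thesis
    using le by (simp add: nn_integral_eq_integral[OF int(1)] nn_integral_eq_integral[OF int(2)] flip: ennreal_plus)
qed

lemma measurable_Phi:
  assumes v: "continuous_on UNIV v" and w: "continuous_on UNIV (curl v)"
  shows "(\<lambda>(x, y). Phi v x y) \<in> borel_measurable (lborel \<Otimes>\<^sub>M lborel)"
proof -
  have [continuous_intros]: "continuous_on A (\<lambda>z. v (f z))" "continuous_on A (\<lambda>z. curl v (f z))"
    if "continuous_on A f" for A and f :: "(real^3) \<times> (real^3) \<Rightarrow> real^3"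
    using continuous_on_compose2[OF v that] continuous_on_compose2[OF w that] by auto
  have "(\<lambda>z. curl v (fst z) \<bullet> ((fst z - snd z) \<times> (v (snd z) \<times> curl v (snd z)))) \<in> borel_measurable borel"
    by (intro borel_measurable_continuous_onI continuous_intros continuous_on_cross)
  moreover have "(\<lambda>z::(real^3) \<times> (real^3). norm (fst z - snd z) ^ 3) \<in> borel_measurable borel"
    by (intro borel_measurable_continuous_onI continuous_intros)
  ultimately have "(\<lambda>z. Phi v (fst z) (snd z)) \<in> borel_measurable borel"
    unfolding Phi_def by (intro borel_measurable_times borel_measurable_divide borel_measurable_const)
  then show ?thesis
    by (simp add: lborel_prod case_prod_beta')
qed

text \<open>The same kernel read in two ways, as the integrand of the representation formula in the variable \<open>y\<close>
  based at \<open>x\<close>, and in the variable \<open>x\<close> based at \<open>y\<close>.\<close>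

lemma Phi_eq:
  "Phi v x y = 1 / (4 * pi) * (((y - x) \<bullet> (curl v x \<times> (v y \<times> curl v y))) / norm (y - x)^3)"
  "Phi v x y = 1 / (4 * pi) * (((x - y) \<bullet> ((v y \<times> curl v y) \<times> curl v x)) / norm (x - y)^3)"
proof -
  have triple: "a \<bullet> (z \<times> w) = - z \<bullet> (a \<times> w)" "a \<bullet> (z \<times> w) = z \<bullet> (w \<times> a)" for a z w :: "real^3"
    by (simp_all add: inner_vec_def sum_3 cross3_def algebra_simps)
  show "Phi v x y = 1 / (4 * pi) * (((x - y) \<bullet> ((v y \<times> curl v y) \<times> curl v x)) / norm (x - y)^3)"
    unfolding Phi_def by (subst triple(2)) (rule refl)
  show "Phi v x y = 1 / (4 * pi) * (((y - x) \<bullet> (curl v x \<times> (v y \<times> curl v y))) / norm (y - x)^3)"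
    unfolding Phi_def by (subst triple(1)) (simp add: norm_minus_commute)
qed

text \<open>Taking the curl removes the pressure gradient and turns the convective term into \<open>- curl (v \<times> \<omega>)\<close>.\<close>

lemma vorticity_equation:
  assumes "smooth_stationary_NS v p"
  shows "laplacian (curl v) x = - curl (\<lambda>y. v y \<times> curl v y) x"
proof -
  have v: "C_k k v" and p: "C_k k p" for k
    using assms by (auto simp: smooth_stationary_NS_def intro: smooth_C_k)
  have NS: "laplacian v = (\<lambda>x. convective v v x + grad p x)"
    using assms by (auto simp: smooth_stationary_NS_def)
  note C1 = curl_convective(1)[OF v] curl_grad(1)[OF p]
  note d = C_k_1_differentiable[OF C1(1)] C_k_1_differentiable[OF C1(2)]
  have "curl (laplacian v) x = curl (convective v v) x + curl (grad p) x"
    unfolding NS curl_eq[OF C_k_1_differentiable[OF C_k_add[OF C1]]] curl_eq[OF d(1)] curl_eq[OF d(2)]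
    by (simp add: partial_add[OF d] cross_add_right sum.distrib)
  then show ?thesis
    by (simp add: laplacian_curl[OF v] curl_convective(2)[OF v] curl_grad(2)[OF p])
qed

theorem theorem1p1:
  fixes v :: "real^3 \<Rightarrow> real^3" and p :: "real^3 \<Rightarrow> real"
  assumes "smooth_stationary_NS v p"
    and "((\<lambda>x. norm (v x)) \<longlongrightarrow> 0) at_infinity"
    and "\<exists>q. 3 / 2 \<le> q \<and> q < 3 \<and> in_Lp q (curl v)"
  shows "(\<forall>x. v x = 0) \<or>
    ((\<integral>\<^sup>+ y. (\<integral>\<^sup>+ x. ennreal (Phi_pos v x y) \<partial>lborel) \<partial>lborel) = \<infinity> \<and>
     (\<integral>\<^sup>+ y. (\<integral>\<^sup>+ x. ennreal (Phi_neg v x y) \<partial>lborel) \<partial>lborel) = \<infinity>)"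
proof -
  let ?\<omega> = "curl v" and ?w = "\<lambda>y. v y \<times> curl v y" and ?c = "bump_mass / (4 * pi)"
  obtain q where q_range: "3 / 2 \<le> q" "q < 3" and Lq: "integrable lborel (\<lambda>x. norm (?\<omega> x) powr q)"
    using assms(3) unfolding in_Lp_def by blast
  then have q: "1 < q" "q < 3" by linarith+
  have v: "C_k k v" for k
    using assms(1) by (auto simp: smooth_stationary_NS_def intro: smooth_C_k)
  have \<omega>: "C_k k ?\<omega>" and w: "C_k k ?w" for k
    by (intro C_k_cross C_k_curl v)+
  note cv = C_k_continuous[OF v[of 0]] and c\<omega> = C_k_continuous[OF \<omega>[of 0]]
  have c: "0 < ?c" using bump_mass_pos by simp
  obtain B where B: "0 \<le> B" "\<And>x. norm (v x) \<le> B"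
  proof -
    obtain b where b: "\<And>x. b \<le> norm x \<Longrightarrow> norm (v x) < 1"
      using order_tendstoD(2)[OF assms(2), of 1] by (auto simp: eventually_at_infinity)
    have "bounded (v ` cball 0 b)"
      by (intro compact_imp_bounded compact_continuous_image continuous_on_subset[OF cv]) auto
    then obtain B where "\<And>x. norm x \<le> b \<Longrightarrow> norm (v x) \<le> B"
      unfolding bounded_iff by (metis image_eqI mem_cball_0)
    then show thesis
      using b by (intro that[of "max 1 B"]) (auto, smt (verit))
  qed
  have smallv: "\<exists>g. integrable lborel g \<and> (\<forall>x. \<bar>a \<bullet> v x\<bar> \<le> \<delta> + g x)" if "0 < \<delta>" for a \<delta>
    by (rule small_plus_integrable_inner[OF decay_imp_small_plus_integrable[OF cv assms(2)] that])
  have small\<omega>: "\<exists>g. integrable lborel g \<and> (\<forall>x. \<bar>a \<bullet> ?\<omega> x\<bar> \<le> \<delta> + g x)" if "0 < \<delta>" for a \<delta>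
    by (rule small_plus_integrable_inner[OF Lp_imp_small_plus_integrable[OF Lq q(1)] that])
  have Lv: "integrable lborel (\<lambda>z. norm (a \<times> ?\<omega> z) powr q)" for a
    by (rule integrable_powr_bound[OF Lq C_k_continuous[OF C_k_cross[OF C_k_const \<omega>[of 0]]], of _ "norm a"])
      (use q in \<open>auto intro: norm_cross_le\<close>)
  have L\<omega>: "integrable lborel (\<lambda>z. norm (a \<times> ?w z) powr q)" for a
  proof (rule integrable_powr_bound[OF Lq C_k_continuous[OF C_k_cross[OF C_k_const w[of 0]]], of _ "norm a * B"])
    show "norm (a \<times> ?w z) \<le> norm a * B * norm (?\<omega> z)" for z
    proof -
      have "norm (a \<times> ?w z) \<le> norm a * (norm (v z) * norm (?\<omega> z))"
        by (rule order_trans[OF norm_cross_le mult_left_mono[OF norm_cross_le]]) simp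
      also have "\<dots> \<le> norm a * (B * norm (?\<omega> z))"
        by (intro mult_left_mono mult_right_mono B) auto
      finally show ?thesis by (simp add: mult.assoc)
    qed
  qed (use q B in auto)
  have eqv: "laplacian (\<lambda>y. a \<bullet> v y) x = divergence (\<lambda>y. a \<times> ?\<omega> y) x" for a x
    using assms(1)
    by (simp add: laplacian_inner_const[OF v] divergence_cross_const[OF \<omega>] curl_curl_div_free[OF v] smooth_stationary_NS_def)
  have eq\<omega>: "laplacian (\<lambda>y. a \<bullet> ?\<omega> y) x = divergence (\<lambda>y. a \<times> ?w y) x" for a x
    by (simp add: laplacian_inner_const[OF \<omega>] divergence_cross_const[OF w] vorticity_equation[OF assms(1)])
  have Cv: "C_k 2 (\<lambda>y. a \<bullet> v y)" and C\<omega>: "C_k 2 (\<lambda>y. a \<bullet> ?\<omega> y)" for a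
    by (intro C_k_bounded_linear[OF bounded_linear_inner_right] v \<omega>)+
  have repv: "integrable lborel (\<lambda>y. ((y - x) \<bullet> (a \<times> ?\<omega> y)) / norm (y - x)^3)"
      "(LINT y|lborel. ((y - x) \<bullet> (a \<times> ?\<omega> y)) / norm (y - x)^3) = - (bump_mass * (a \<bullet> v x))" for a x
    by (rule newtonian_representation[OF Cv C_k_cross[OF C_k_const \<omega>] eqv q Lv smallv]; assumption)+
  have rep\<omega>: "integrable lborel (\<lambda>y. ((y - x) \<bullet> (a \<times> ?w y)) / norm (y - x)^3)"
      "(LINT y|lborel. ((y - x) \<bullet> (a \<times> ?w y)) / norm (y - x)^3) = - (bump_mass * (a \<bullet> ?\<omega> x))" for a x
    by (rule newtonian_representation[OF C\<omega> C_k_cross[OF C_k_const w] eq\<omega> q L\<omega> small\<omega>]; assumption)+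
  \<comment> \<open>The integral over \<open>x\<close> vanishes because \<open>v y \<times> curl v y\<close> is orthogonal to \<open>v y\<close>.\<close>
  have x: "integrable lborel (\<lambda>x. Phi v x y)" "(LINT x|lborel. Phi v x y) = 0" for y
  proof -
    show "integrable lborel (\<lambda>x. Phi v x y)"
      unfolding Phi_eq(2) by (intro integrable_mult_right repv)
    have "?w y \<bullet> v y = 0" by (simp add: dot_cross_self)
    then show "(LINT x|lborel. Phi v x y) = 0"
      unfolding Phi_eq(2) integral_mult_right_zero repv(2) by simp
  qed
  have y: "integrable lborel (\<lambda>y. Phi v x y)" "(LINT y|lborel. Phi v x y) = - (?c * norm (?\<omega> x)^2)" for x
  proof -
    show "integrable lborel (\<lambda>y. Phi v x y)"
      unfolding Phi_eq(1) by (intro integrable_mult_right rep\<omega>)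
    show "(LINT y|lborel. Phi v x y) = - (?c * norm (?\<omega> x)^2)"
      unfolding Phi_eq(1) integral_mult_right_zero rep\<omega>(2) by (simp add: power2_norm_eq_inner)
  qed
  \<comment> \<open>The same quantity \<open>A\<close> is computed in both orders of integration.\<close>
  define A where "A = (\<integral>\<^sup>+ y. (\<integral>\<^sup>+ x. ennreal (Phi_pos v x y) \<partial>lborel) \<partial>lborel)"
  define E where "E = (\<integral>\<^sup>+ x. ennreal (?c * norm (?\<omega> x)^2) \<partial>lborel)"
  have A: "(\<integral>\<^sup>+ y. (\<integral>\<^sup>+ x. ennreal (Phi_neg v x y) \<partial>lborel) \<partial>lborel) = A"
    unfolding A_def Phi_neg_def Phi_pos_def
    by (rule nn_integral_cong) (subst nn_integral_neg_part[OF x(1)], simp_all add: x(2))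
  note [measurable] = measurable_Phi[OF cv c\<omega>] borel_measurable_continuous_onI[OF c\<omega>]
  have mp: "(\<lambda>(x, y). ennreal (Phi_pos v x y)) \<in> borel_measurable (lborel \<Otimes>\<^sub>M lborel)"
    and mn: "(\<lambda>(x, y). ennreal (Phi_neg v x y)) \<in> borel_measurable (lborel \<Otimes>\<^sub>M lborel)"
    unfolding Phi_pos_def Phi_neg_def by measurable
  have "A = (\<integral>\<^sup>+ x. (\<integral>\<^sup>+ y. ennreal (Phi_neg v x y) \<partial>lborel) \<partial>lborel)"
    using lborel_pair.Fubini'[OF mn] A by simp
  also have "\<dots> = (\<integral>\<^sup>+ x. (\<integral>\<^sup>+ y. ennreal (Phi_pos v x y) \<partial>lborel) + ennreal (?c * norm (?\<omega> x)^2) \<partial>lborel)"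
    unfolding Phi_neg_def Phi_pos_def using less_imp_le[OF bump_mass_pos]
    by (intro nn_integral_cong, subst nn_integral_neg_part[OF y(1)]) (simp_all add: y(2))
  also have "\<dots> = (\<integral>\<^sup>+ x. (\<integral>\<^sup>+ y. ennreal (Phi_pos v x y) \<partial>lborel) \<partial>lborel) + E"
    unfolding E_def
    by (intro nn_integral_add lborel.borel_measurable_nn_integral mp) measurable
  also have "(\<integral>\<^sup>+ x. (\<integral>\<^sup>+ y. ennreal (Phi_pos v x y) \<partial>lborel) \<partial>lborel) = A"
    unfolding A_def by (rule lborel_pair.Fubini'[OF mp, symmetric])
  finally have A_absorbs_E: "A = A + E" .
  show ?thesis
  proof (cases "A = \<infinity>")
    case True
    then show ?thesis using A by (simp add: A_def)
  next
    case False
    then have "E = 0"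
      using A_absorbs_E by (metis add.right_neutral ennreal_add_left_cancel infinity_ennreal_def)
    then have "AE x in lborel. ennreal (?c * norm (?\<omega> x)^2) = 0"
      unfolding E_def by (subst (asm) nn_integral_0_iff_AE) measurable
    then have zero: "AE x in lborel. ?\<omega> x = 0"
    proof (rule eventually_mono)
      fix x assume "ennreal (?c * norm (?\<omega> x)^2) = 0"
      then have "?c * norm (?\<omega> x)^2 \<le> 0"
        by (simp only: ennreal_eq_0_iff)
      then have "norm (?\<omega> x)^2 \<le> 0"
        using c by (simp only: mult_le_0_iff) auto
      then show "?\<omega> x = 0" by simp
    qed
    have "v x = 0" for x
    proof -
      have "(LINT y|lborel. ((y - x) \<bullet> (v x \<times> ?\<omega> y)) / norm (y - x)^3) = 0"
        by (rule integral_eq_zero_AE) (use zero in \<open>auto elim!: eventually_mono\<close>)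
      then show ?thesis
        unfolding repv(2) using bump_mass_pos by simp
    qed
    then show ?thesis by simp
  qed
qed

end
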